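(* Let $k$ be a field of characteristic zero, let $n \ge 3$ and $d \ge 1$ be integers, let $R = k[x_1,\ldots,x_{2n}]$, let $L \in R$ be a general linear form, and let $I = \langle x_1^{d}, \ldots, x_{2n}^{d}, L^{d} \rangle$. Then the ring $R/I$ fails the WLP if and only if $d > 1$.
   Context: "General linear form" means that the assertion holds for all linear forms whose coefficient vector lies in some nonempty Zariski-open subset of the space of linear forms $[R]_1$. A standard graded artinian $k$-algebra $A = R/I$ has the Weak Lefschetz Property (WLP) if, for a general linear form $\ell \in R$, the multiplication map $\times \ell : [A]_{t} \to [A]_{t+1}$ has maximal rank (i.e. is injective or surjective) for every integer $t$; otherwise $A$ fails the WLP. *)

theory Defs
  imports "HOL-Algebra.QuotRing" "HOL-Library.Poly_Mapping"
begin

text \<open>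
  Multivariate polynomials over \<open>'a\<close>: finitely supported maps from exponent vectors to
  coefficients. The ring structure (convolution product) is the one of \<open>HOL-Library.Poly_Mapping\<close>.
  The indeterminates are \<open>x\<^sub>0, x\<^sub>1, \<dots>\<close>; the ring in \<open>N\<close> indeterminates consists of the polynomials
  involving only \<open>x\<^sub>i\<close> with \<open>i < N\<close>.
\<close>

type_synonym 'a mpoly = "(nat \<Rightarrow>\<^sub>0 nat) \<Rightarrow>\<^sub>0 'a"

definition mvar :: "nat \<Rightarrow> 'a::field mpoly" where
  "mvar i = Poly_Mapping.single (Poly_Mapping.single i 1) 1"

definition mpoly_ring :: "nat \<Rightarrow> 'a::field mpoly ring" where
  "mpoly_ring N =
     \<lparr>carrier = {p. \<forall>m\<in>Poly_Mapping.keys p. Poly_Mapping.keys m \<subseteq> {..<N}},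
      mult = (*), one = 1, zero = 0, add = (+)\<rparr>"

definition mdegree :: "(nat \<Rightarrow>\<^sub>0 nat) \<Rightarrow> nat" where
  "mdegree m = (\<Sum>i\<in>Poly_Mapping.keys m. Poly_Mapping.lookup m i)"

text \<open>The graded pieces \<open>[R]\<^sub>t\<close> and \<open>[R/I]\<^sub>t\<close>, for every integer \<open>t\<close>; they are zero for \<open>t < 0\<close>.\<close>

definition homog :: "nat \<Rightarrow> int \<Rightarrow> 'a::field mpoly set" where
  "homog N t = {p \<in> carrier (mpoly_ring N). \<forall>m\<in>Poly_Mapping.keys p. int (mdegree m) = t}"

definition quot_homog :: "nat \<Rightarrow> 'a::field mpoly set \<Rightarrow> int \<Rightarrow> 'a mpoly set set" where
  "quot_homog N I t = (\<lambda>p. I +>\<^bsub>mpoly_ring N\<^esub> p) ` homog N t"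

definition meval :: "(nat \<Rightarrow> 'a::field) \<Rightarrow> 'a mpoly \<Rightarrow> 'a" where
  "meval c p = (\<Sum>m\<in>Poly_Mapping.keys p.
     Poly_Mapping.lookup p m * (\<Prod>i\<in>Poly_Mapping.keys m. c i ^ Poly_Mapping.lookup m i))"

text \<open>
  Points of affine \<open>N\<close>-space are the functions on \<open>{..<N}\<close> (extensional, i.e. \<open>undefined\<close> elsewhere).
  The closed sets are the common zero sets of arbitrary sets of polynomials.
\<close>

definition zariski_closed :: "nat \<Rightarrow> (nat \<Rightarrow> 'a::field) set \<Rightarrow> bool" where
  "zariski_closed N Z \<longleftrightarrow>
     (\<exists>S \<subseteq> carrier (mpoly_ring N). Z = {c \<in> {..<N} \<rightarrow>\<^sub>E UNIV. \<forall>f\<in>S. meval c f = 0})"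

definition zariski_open :: "nat \<Rightarrow> (nat \<Rightarrow> 'a::field) set \<Rightarrow> bool" where
  "zariski_open N U \<longleftrightarrow>
     U \<subseteq> ({..<N} \<rightarrow>\<^sub>E UNIV) \<and> zariski_closed N (({..<N} \<rightarrow>\<^sub>E UNIV) - U)"

definition coeff_vec :: "nat \<Rightarrow> 'a::field mpoly \<Rightarrow> nat \<Rightarrow> 'a" where
  "coeff_vec N L = (\<lambda>i\<in>{..<N}. Poly_Mapping.lookup L (Poly_Mapping.single i 1))"

definition for_general_linear_form :: "nat \<Rightarrow> ('a::field mpoly \<Rightarrow> bool) \<Rightarrow> bool" where
  "for_general_linear_form N P \<longleftrightarrow>
     (\<exists>U. zariski_open N U \<and> U \<noteq> {} \<and> (\<forall>L\<in>homog N 1. coeff_vec N L \<in> U \<longrightarrow> P L))"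

text \<open>
  The Weak Lefschetz Property of \<open>A = R/I\<close>, where \<open>R\<close> is the polynomial ring in \<open>N\<close> indeterminates.
  It is meant for homogeneous ideals \<open>I\<close> with artinian quotient.
\<close>

definition WLP :: "nat \<Rightarrow> 'a::field mpoly set \<Rightarrow> bool" where
  "WLP N I \<longleftrightarrow>
     for_general_linear_form N (\<lambda>l. \<forall>t.
       let mult_l = (\<lambda>a. (I +>\<^bsub>mpoly_ring N\<^esub> l) \<otimes>\<^bsub>mpoly_ring N Quot I\<^esub> a) in
         inj_on mult_l (quot_homog N I t) \<or>
         mult_l ` quot_homog N I t = quot_homog N I (t + 1))"

end

theory Submission
  imports Defs "HOL-Computational_Algebra.Polynomial" "HOL-Library.Product_Plus"
begin

text \<open>
Write \<open>N = 2n\<close>, \<open>B = k[x\<^sub>0,\<dots>,x\<^bsub>N-1\<^esub>]/(x\<^sub>i\<^sup>d)\<close>, \<open>A = B/(L\<^sup>d) = R/I\<close>, where \<open>L = \<Sum>a\<^sub>i x\<^sub>i\<close> with all \<open>a\<^sub>i\<close> nonzero,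
and \<open>l = \<Sum>b\<^sub>i x\<^sub>i\<close> for the second linear form. If \<open>d = 1\<close>, then \<open>A = k\<close> and every multiplication map is
trivially of maximal rank. If \<open>d \<ge> 2\<close>, then \<open>\<times>l\<close> from degree \<open>t - 1\<close> to degree \<open>t = n(d - 1)\<close> is neither
injective nor surjective as soon as the \<open>b\<^sub>i\<close> are nonzero and the ratios \<open>s\<^sub>i = a\<^sub>i/b\<^sub>i\<close> are distinct.
Such points \<open>b\<close> exist in every nonempty Zariski-open set (\<open>general_point_exists\<close>).

\<^bold>\<open>Failure of surjectivity.\<close> By apolarity it is enough to find a nonzero form \<open>G\<close> of degree \<open>t\<close> killed by
all \<open>\<partial>\<^sub>i\<^sup>d\<close>, by \<open>L(\<partial>)\<^sup>d\<close> and by \<open>l(\<partial>)\<close>. Dually, \<open>R/(I, l)\<close> corresponds to \<open>2n + 1\<close> points of a projective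
space of dimension \<open>2n - 2\<close>; they lie on a rational normal curve, and the \<open>n \<times> n\<close> Hankel determinant \<open>H\<close>
(the equation of a secant variety of that curve) has multiplicity \<open>n - 1\<close> along it. In the given
coordinates \<open>H = det (\<Sum>w\<^sub>i x\<^sub>i v\<^sub>i v\<^sub>i\<^sup>T)\<close> with \<open>v\<^sub>i = (1, s\<^sub>i, \<dots>, s\<^sub>i\<^bsup>n-1\<^esup>)\<close> and suitable scalars \<open>w\<^sub>i\<close>. Each
\<open>x\<^sub>i\<close> and also the direction \<open>a\<close> contributes a matrix of rank one, and the direction \<open>b\<close> contributes
zero; hence \<open>\<partial>\<^sub>i\<^sup>2\<close>, \<open>L(\<partial>)\<^sup>2\<close> and \<open>l(\<partial>)\<close> kill \<open>H\<close>, and \<open>G = H\<^bsup>d-1\<^esup>\<close> is as required. Expanding the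
determinant over the \<open>n\<close>-subsets of the variables turns all of this into Lagrange interpolation at
the points \<open>s\<^sub>i\<close> (\<open>divided_difference\<close>, \<open>dual_generator_exists\<close>).

\<^bold>\<open>Failure of injectivity.\<close> Two facts about \<open>B\<close> enter. Multiplication by \<open>L\<close> is injective below the middle
degree \<open>t\<close>, because \<open>B\<close> is a representation of \<open>sl\<^sub>2\<close> with \<open>L\<close> as raising operator
(\<open>lform_injective\<close>); and the Hilbert function \<open>h\<close> of \<open>B\<close> satisfies
\<open>h(t) - h(t - d) \<le> h(t - 1) - h(t - 1 - d)\<close> when \<open>n \<ge> 3\<close> (\<open>card_small_monoms_ineq\<close>). Consider the map
\<open>(p, q) \<mapsto> l p - L\<^sup>d q\<close> from degrees \<open>(t - 1, t - d)\<close> to degree \<open>t\<close> of \<open>B\<close>. Its image lies in the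
hyperplane defined by \<open>G\<close>, so by the inequality its kernel is larger than the space of trivial
solutions \<open>(L\<^sup>d r, l r)\<close>. For any further solution, \<open>p\<close> is a nonzero element of \<open>A\<close> killed by \<open>l\<close>: if
\<open>p = L\<^sup>d r\<close>, then injectivity of \<open>L\<^sup>d\<close> gives \<open>q = l r\<close> (\<open>multiplication_kernel\<close>).
\<close>

section \<open>Polynomials and monomials\<close>

abbreviation lookup :: "('a \<Rightarrow>\<^sub>0 'b::zero) \<Rightarrow> 'a \<Rightarrow> 'b" where
  "lookup \<equiv> Poly_Mapping.lookup"

definition evar :: "nat \<Rightarrow> nat \<Rightarrow>\<^sub>0 nat" where
  "evar i = Poly_Mapping.single i 1"

lemma lookup_evar: "lookup (evar i) k = (if k = i then 1 else 0)"
  by (simp add: evar_def lookup_single when_def)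

lemma keys_evar [simp]: "Poly_Mapping.keys (evar i) = {i}"
  by (simp add: evar_def)

lemma mpoly_induct [case_names single add]:
  fixes p :: "'a::comm_monoid_add mpoly"
  assumes single: "\<And>m c. P (Poly_Mapping.single m c)"
    and add: "\<And>p q. P p \<Longrightarrow> P q \<Longrightarrow> P (p + q)"
  shows "P p"
proof -
  have "P (\<Sum>m\<in>A. Poly_Mapping.single m (lookup p m))" if "finite A" for A
    using that by induction (use single[of 0 0] in \<open>auto intro: single add\<close>)
  moreover have "p = (\<Sum>m\<in>Poly_Mapping.keys p. Poly_Mapping.single m (lookup p m))"
    by (rule poly_mapping_eqI)
       (auto simp: lookup_sum lookup_single when_def in_keys_iff)
  ultimately show ?thesis by (metis finite_keys)
qed

lemma minus_evar_plus_evar: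
  assumes "lookup m i \<noteq> 0"
  shows "m - evar i + evar i = m"
  using assms by (auto simp: poly_mapping_eq_iff fun_eq_iff lookup_add lookup_minus lookup_evar)

lemma lookup_var_times:
  fixes p :: "'a::comm_semiring_1 mpoly"
  shows "lookup (Poly_Mapping.single (evar i) c * p) k =
           (if lookup k i = 0 then 0 else c * lookup p (k - evar i))"
proof (induction p rule: mpoly_induct)
  case (single m b)
  have "evar i + m = k \<longleftrightarrow> lookup k i \<noteq> 0 \<and> m = k - evar i"
    by (auto simp: poly_mapping_eq_iff fun_eq_iff lookup_add lookup_minus lookup_evar)
  then show ?case by (auto simp: mult_single lookup_single when_def)
next
  case (add p q)
  then show ?case by (simp add: distrib_left lookup_add)
qed

lemma lookup_const_times: "lookup (Poly_Mapping.single 0 c * p) k = c * lookup p k"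
  for p :: "'a::comm_semiring_1 mpoly"
  by (induction p rule: mpoly_induct)
     (auto simp: mult_single lookup_single when_def distrib_left lookup_add)

lemma lookup_of_nat_times: "lookup (of_nat h * p) k = of_nat h * lookup p k"
  for p :: "'a::comm_semiring_1 mpoly"
  using lookup_const_times[of "of_nat h" p k] by simp

lemma mdegree_eq_sum:
  assumes "Poly_Mapping.keys m \<subseteq> A" "finite A"
  shows "mdegree m = (\<Sum>i\<in>A. lookup m i)"
  unfolding mdegree_def
  by (rule sum.mono_neutral_left) (use assms in \<open>auto simp: in_keys_iff\<close>)

lemma mdegree_add: "mdegree (m + k) = mdegree m + mdegree k"
proof -
  let ?A = "Poly_Mapping.keys m \<union> Poly_Mapping.keys k"
  have "Poly_Mapping.keys (m + k) \<subseteq> ?A" by (rule Poly_Mapping.keys_add)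
  then show ?thesis
    by (subst (1 2 3) mdegree_eq_sum[where A = ?A]) (auto simp: lookup_add sum.distrib)
qed

lemma mdegree_single [simp]: "mdegree (Poly_Mapping.single i a) = a"
  by (simp add: mdegree_def)

lemma mdegree_evar [simp]: "mdegree (evar i) = 1"
  by (simp add: mdegree_def lookup_evar)

lemma mdegree_eq_0_iff: "mdegree m = 0 \<longleftrightarrow> m = 0"
  by (auto simp: mdegree_def in_keys_iff intro!: poly_mapping_eqI)

definition lform :: "nat \<Rightarrow> (nat \<Rightarrow> 'a::field) \<Rightarrow> 'a mpoly" where
  "lform N a = (\<Sum>i<N. Poly_Mapping.single (evar i) (a i))"

lemma lookup_lform_times:
  "lookup (lform N a * p) k =
     (\<Sum>i<N. if lookup k i = 0 then 0 else a i * lookup p (k - evar i))"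
  by (simp add: lform_def sum_distrib_right lookup_sum lookup_var_times)

text \<open>
The basis of the component of degree \<open>j\<close> of \<open>B = k[x\<^sub>0,\<dots>,x\<^bsub>N-1\<^esub>]/(x\<^sub>i\<^sup>d)\<close>. The degree is an integer, so
that shifts by \<open>d\<close> need no case distinction.
\<close>

definition small_monoms :: "nat \<Rightarrow> nat \<Rightarrow> int \<Rightarrow> (nat \<Rightarrow>\<^sub>0 nat) set" where
  "small_monoms d N j =
     {m. Poly_Mapping.keys m \<subseteq> {..<N} \<and> (\<forall>i. lookup m i < d) \<and> int (mdegree m) = j}"

text \<open>
The component of degree \<open>j\<close> of \<open>p\<close> is zero in \<open>B\<close>. Since \<open>p\<close> itself may be inhomogeneous, computations
in one degree of \<open>B\<close> can be done with representatives, without projecting to that degree.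
\<close>

definition vanish :: "nat \<Rightarrow> nat \<Rightarrow> int \<Rightarrow> 'a::zero mpoly \<Rightarrow> bool" where
  "vanish d N j p \<longleftrightarrow> (\<forall>m\<in>small_monoms d N j. lookup p m = 0)"

lemma vanish_add: "vanish d N j p \<Longrightarrow> vanish d N j q \<Longrightarrow> vanish d N j (p + q :: 'a::comm_monoid_add mpoly)"
  by (simp add: vanish_def lookup_add)

lemma vanish_diff: "vanish d N j p \<Longrightarrow> vanish d N j q \<Longrightarrow> vanish d N j (p - q :: 'a::ab_group_add mpoly)"
  by (simp add: vanish_def lookup_minus)

lemma small_monoms_minus_evar:
  assumes "m \<in> small_monoms d N (j + 1)" "lookup m i \<noteq> 0"
  shows "m - evar i \<in> small_monoms d N j"
proof -
  have "m = (m - evar i) + evar i"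
    using assms(2) by (auto simp: poly_mapping_eq_iff fun_eq_iff lookup_add lookup_minus lookup_evar)
  then have "mdegree m = mdegree (m - evar i) + 1"
    by (metis mdegree_add mdegree_evar)
  moreover have "Poly_Mapping.keys (m - evar i) \<subseteq> Poly_Mapping.keys m"
    by (auto simp: in_keys_iff lookup_minus)
  moreover have "lookup (m - evar i) k < d" for k
    using assms(1) by (auto simp: small_monoms_def lookup_minus intro: le_less_trans[OF diff_le_self])
  ultimately show ?thesis using assms(1) by (auto simp: small_monoms_def)
qed

lemma small_monoms_plus_evar:
  assumes "m \<in> small_monoms d N j" "i < N" "Suc (lookup m i) < d"
  shows "m + evar i \<in> small_monoms d N (j + 1)"
proof -
  have "Poly_Mapping.keys (m + evar i) \<subseteq> {..<N}"
    using assms Poly_Mapping.keys_add[of m "evar i"] by (auto simp: small_monoms_def)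
  then show ?thesis using assms
    by (auto simp: small_monoms_def mdegree_add lookup_add lookup_evar)
qed

lemma vanish_lform_times:
  assumes "vanish d N j p"
  shows "vanish d N (j + 1) (lform N a * p)"
  using assms small_monoms_minus_evar
  by (auto simp: vanish_def lookup_lform_times intro!: sum.neutral)

lemma vanish_lform_power_times:
  assumes "vanish d N j p"
  shows "vanish d N (j + int e) (lform N a ^ e * p)"
proof (induction e)
  case (Suc e)
  then show ?case using vanish_lform_times[OF Suc, of a] by (simp add: algebra_simps)
qed (use assms in simp)

section \<open>Injectivity below the middle degree\<close>

text \<open>
The common shape of the partial derivatives and of the lowering operators of \<open>sl\<^sub>2\<close>: a shift by \<open>x\<^sub>i\<close>,
weighted by the exponents of the target monomial.
\<close>

definition lower :: "nat \<Rightarrow> ((nat \<Rightarrow>\<^sub>0 nat) \<Rightarrow> 'a) \<Rightarrow> 'a::semiring_0 mpoly \<Rightarrow> 'a mpoly" where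
  "lower i g p = Poly_Mapping.mapp (\<lambda>m c. g m * c) (Poly_Mapping.map_key (\<lambda>m. m + evar i) p)"

lemma lookup_lower: "lookup (lower i g p) m = g m * lookup p (m + evar i)"
proof -
  have "inj (\<lambda>m :: nat \<Rightarrow>\<^sub>0 nat. m + evar i)" by (auto simp: inj_def)
  then have "lookup (Poly_Mapping.map_key (\<lambda>m. m + evar i) p) m = lookup p (m + evar i)"
    by (simp add: map_key.rep_eq)
  then show ?thesis by (auto simp: lower_def lookup_mapp when_def in_keys_iff)
qed

text \<open>
On \<open>k[x]/(x\<^sup>d)\<close> the operator \<open>x\<^sup>k \<mapsto> k(d - k)x\<^bsup>k-1\<^esup>\<close> and multiplication by \<open>x\<close> generate the irreducible
representation of \<open>sl\<^sub>2\<close> of dimension \<open>d\<close>. The coefficient is indexed by the target exponent \<open>k - 1\<close>; it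
vanishes at \<open>d - 1\<close>, which is why the operator is well defined modulo \<open>x\<^sup>d\<close>.
\<close>

definition sl2_coeff :: "nat \<Rightarrow> nat \<Rightarrow> (nat \<Rightarrow>\<^sub>0 nat) \<Rightarrow> 'a::field" where
  "sl2_coeff d i m = of_nat (lookup m i + 1) * (of_nat d - 1 - of_nat (lookup m i))"

definition sl2_lower :: "nat \<Rightarrow> nat \<Rightarrow> (nat \<Rightarrow> 'a::field) \<Rightarrow> 'a mpoly \<Rightarrow> 'a mpoly" where
  "sl2_lower d N a p = (\<Sum>i<N. lower i (\<lambda>m. inverse (a i) * sl2_coeff d i m) p)"

lemma lookup_sl2_lower:
  "lookup (sl2_lower d N a p) m = (\<Sum>i<N. inverse (a i) * sl2_coeff d i m * lookup p (m + evar i))"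
  by (simp add: sl2_lower_def lookup_sum lookup_lower)

text \<open>
Operators belonging to different variables commute, and in one variable
\<open>(k + 1)(d - 1 - k) - k(d - k) = d - 1 - 2k\<close>. The factors \<open>a\<^sub>i\<^sup>-\<^sup>1\<close> in the lowering operator cancel the
coefficients of the linear form.
\<close>

lemma sl2_commutator:
  fixes a :: "nat \<Rightarrow> 'a::field"
  assumes a: "\<And>i. i < N \<Longrightarrow> a i \<noteq> 0" and m: "m \<in> small_monoms d N j"
  shows "lookup (sl2_lower d N a (lform N a * p)) m =
         lookup (lform N a * sl2_lower d N a p) m + of_int (int N * (int d - 1) - 2 * j) * lookup p m"
proof -
  \<comment> \<open>Multiplication by \<open>a\<^sub>k x\<^sub>k\<close> precedes lowering at \<open>i\<close> in \<open>u i k\<close> and follows it in \<open>v i k\<close>.\<close>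
  define u where "u i k = inverse (a i) * sl2_coeff d i m *
      (if lookup (m + evar i) k = 0 then 0 else a k * lookup p (m + evar i - evar k))" for i k
  define v where "v i k = (if lookup m k = 0 then 0 else
      a k * (inverse (a i) * sl2_coeff d i (m - evar k) * lookup p (m - evar k + evar i)))" for i k
  have off: "u i k = v i k" if "i \<noteq> k" for i k
  proof -
    have "m + evar i - evar k = m - evar k + evar i" if "lookup m k \<noteq> 0"
      using that \<open>i \<noteq> k\<close>
      by (auto simp: poly_mapping_eq_iff fun_eq_iff lookup_add lookup_minus lookup_evar)
    then show ?thesis using that
      by (auto simp: u_def v_def sl2_coeff_def lookup_add lookup_minus lookup_evar)
  qed
  have diag: "u i i = v i i + (of_int (int d - 1) - 2 * of_nat (lookup m i)) * lookup p m" if "i < N" for i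
  proof -
    have 1: "m + evar i - evar i = m" by simp
    have 2: "m - evar i + evar i = m" if "lookup m i \<noteq> 0"
      using that by (auto simp: poly_mapping_eq_iff fun_eq_iff lookup_add lookup_minus lookup_evar)
    have u: "u i i = sl2_coeff d i m * lookup p m"
      using a[OF that] by (simp add: u_def 1 lookup_add lookup_evar)
    show ?thesis
    proof (cases "lookup m i")
      case 0
      then show ?thesis unfolding u by (simp add: v_def sl2_coeff_def)
    next
      case (Suc k)
      have v: "v i i = sl2_coeff d i (m - evar i) * lookup p m"
        using a[OF that] Suc 2 by (simp add: v_def)
      show ?thesis unfolding u v using Suc
        by (simp add: sl2_coeff_def lookup_minus lookup_evar algebra_simps)
    qed
  qed
  have "lookup (sl2_lower d N a (lform N a * p)) m = (\<Sum>i<N. \<Sum>k<N. u i k)"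
    by (simp add: lookup_sl2_lower lookup_lform_times u_def sum_distrib_left)
  also have "\<dots> = (\<Sum>i<N. (\<Sum>k<N. v i k) + (of_int (int d - 1) - 2 * of_nat (lookup m i)) * lookup p m)"
  proof (rule sum.cong[OF refl])
    fix i assume i: "i \<in> {..<N}"
    have "(\<Sum>k<N. u i k) = u i i + (\<Sum>k\<in>{..<N} - {i}. u i k)"
      using i by (simp add: sum.remove)
    also have "(\<Sum>k\<in>{..<N} - {i}. u i k) = (\<Sum>k\<in>{..<N} - {i}. v i k)"
      by (rule sum.cong) (auto intro: off)
    also have "u i i + \<dots> = (\<Sum>k<N. v i k) + (of_int (int d - 1) - 2 * of_nat (lookup m i)) * lookup p m"
      using i diag[of i] sum.remove[of "{..<N}" i "v i"] by simp
    finally show "(\<Sum>k<N. u i k) = \<dots>" .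
  qed
  also have "\<dots> = (\<Sum>i<N. \<Sum>k<N. v i k) +
      (of_int (int N * (int d - 1)) - 2 * of_nat (\<Sum>i<N. lookup m i)) * lookup p m"
    by (simp add: sum.distrib sum_distrib_right[symmetric] sum_subtractf sum_distrib_left[symmetric])
  also have "(\<Sum>i<N. lookup m i) = nat j"
  proof -
    have "mdegree m = nat j" using m by (auto simp: small_monoms_def)
    then show ?thesis using m mdegree_eq_sum[of m "{..<N}"] by (simp add: small_monoms_def)
  qed
  also have "of_nat (nat j) = (of_int j :: 'a)"
    using m by (auto simp: small_monoms_def)
  also have "(\<Sum>i<N. \<Sum>k<N. v i k) = lookup (lform N a * sl2_lower d N a p) m"
    by (subst sum.swap)
       (auto simp: lookup_sl2_lower lookup_lform_times v_def sum_distrib_left intro!: sum.cong)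
  finally show ?thesis by (simp add: algebra_simps)
qed

lemma vanish_sl2_lower:
  assumes "vanish d N (j + 1) p"
  shows "vanish d N j (sl2_lower d N a p)"
  unfolding vanish_def
proof
  fix m assume m: "m \<in> small_monoms d N j"
  have "sl2_coeff d i m * lookup p (m + evar i) = 0" if "i < N" for i
  proof (cases "Suc (lookup m i) < d")
    case True
    then show ?thesis using assms small_monoms_plus_evar[OF m that] by (simp add: vanish_def)
  next
    case False
    then have "d = Suc (lookup m i)" using m by (auto simp: small_monoms_def not_less intro: le_antisym Suc_leI)
    then show ?thesis by (simp add: sl2_coeff_def)
  qed
  then show "lookup (sl2_lower d N a p) m = 0"
    by (auto simp: lookup_sl2_lower mult.assoc intro!: sum.neutral)
qed

text \<open>
Let \<open>F\<close> be the lowering operator and \<open>h = N(d - 1) - 2j\<close>. If \<open>F L p = -\<mu> p\<close> in degree \<open>j\<close>, then the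
commutator gives \<open>L F p = -(\<mu> + h) p\<close>, and applying \<open>F\<close> once more shows that \<open>F p\<close> satisfies the same
hypothesis in degree \<open>j - 1\<close> with \<open>\<mu> + h\<close> in place of \<open>\<mu>\<close>. By induction \<open>F p = 0\<close>, hence
\<open>(\<mu> + h) p = 0\<close>; below the middle degree \<open>\<mu> + h > 0\<close>.
\<close>

lemma lform_injective_aux:
  fixes a :: "nat \<Rightarrow> 'a::field_char_0"
  assumes a: "\<And>i. i < N \<Longrightarrow> a i \<noteq> 0"
    and "2 * int j < int N * (int d - 1)"
    and "\<forall>m\<in>small_monoms d N (int j).
           lookup (sl2_lower d N a (lform N a * p)) m = - of_nat \<mu> * lookup p m"
  shows "vanish d N (int j) p"
  using assms(2,3)
proof (induction j arbitrary: p \<mu>)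
  case 0
  show ?case unfolding vanish_def
  proof
    fix m assume m: "m \<in> small_monoms d N (int 0)"
    then have "m = 0" using mdegree_eq_0_iff by (auto simp: small_monoms_def)
    then have "lookup (lform N a * sl2_lower d N a p) m = 0" by (simp add: lookup_lform_times)
    with sl2_commutator[where N = N and a = a and p = p, OF a m] m 0(2)
    have "(of_int (int N * (int d - 1)) + of_int (int \<mu>)) * lookup p m = (0::'a)"
      by (simp add: algebra_simps)
    then have "of_int (int N * (int d - 1) + int \<mu>) * lookup p m = (0::'a)" by simp
    moreover have "int N * (int d - 1) + int \<mu> \<noteq> 0" using 0(1) by simp
    ultimately show "lookup p m = 0" by (metis mult_eq_0_iff of_int_eq_0_iff)
  qed
next
  case (Suc j)
  let ?F = "sl2_lower d N a" and ?L = "lform N a"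
  define h where "h = nat (int N * (int d - 1) - 2 * int (Suc j) + int \<mu>)"
  have h: "int h = int N * (int d - 1) - 2 * int (Suc j) + int \<mu>" "h > 0"
    using Suc.prems(1) by (auto simp: h_def)
  have LF: "lookup (?L * ?F p) m = - of_nat h * lookup p m" if m: "m \<in> small_monoms d N (int (Suc j))" for m
  proof -
    have "int N * (int d - 1) - 2 * int (Suc j) = int h - int \<mu>"
      by (simp add: h(1))
    then have "of_int (int N * (int d - 1) - 2 * int (Suc j)) = (of_nat h - of_nat \<mu> :: 'a)"
      by (metis of_int_diff of_int_of_nat_eq)
    with sl2_commutator[where N = N and a = a and p = p, OF a m]
    have "lookup (?F (?L * p)) m = lookup (?L * ?F p) m + (of_nat h - of_nat \<mu>) * lookup p m"
      by simp
    then show ?thesis using Suc.prems(2) m by (simp add: algebra_simps eq_neg_iff_add_eq_0)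
  qed
  have "vanish d N (int j + 1) (?L * ?F p + of_nat h * p)"
    using LF by (auto simp: vanish_def lookup_add lookup_of_nat_times add.commute)
  from vanish_sl2_lower[OF this, of a]
  have v: "vanish d N (int j) (?F (?L * ?F p + of_nat h * p))" .
  have "lookup (?F (q + of_nat h * p)) m = lookup (?F q) m + of_nat h * lookup (?F p) m" for q m
    by (simp add: lookup_sl2_lower lookup_add lookup_of_nat_times distrib_left sum.distrib
        sum_distrib_left mult.left_commute)
  with v have "vanish d N (int j) (?F p)"
    by (intro Suc.IH[of "?F p" h])
       (use Suc.prems(1) in \<open>auto simp: vanish_def eq_neg_iff_add_eq_0\<close>)
  from vanish_lform_times[OF this, of a] have "of_nat h * lookup p m = 0"
    if "m \<in> small_monoms d N (int (Suc j))" for m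
    using LF[OF that] that by (simp add: vanish_def add.commute)
  then show ?case using h(2) by (simp add: vanish_def)
qed

lemma lform_injective:
  fixes a :: "nat \<Rightarrow> 'a::field_char_0"
  assumes a: "\<And>i. i < N \<Longrightarrow> a i \<noteq> 0"
    and j: "2 * j < int N * (int d - 1)"
    and v: "vanish d N (j + 1) (lform N a * p)"
  shows "vanish d N j p"
proof (cases "j < 0")
  case True
  then show ?thesis by (auto simp: vanish_def small_monoms_def)
next
  case False
  then show ?thesis
    using lform_injective_aux[where N = N and j = "nat j" and p = p and \<mu> = 0, OF a] vanish_sl2_lower[OF v, of a] j
    by (auto simp: vanish_def)
qed

lemma lform_power_injective:
  fixes a :: "nat \<Rightarrow> 'a::field_char_0"
  assumes a: "\<And>i. i < N \<Longrightarrow> a i \<noteq> 0"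
    and "2 * (j + int e) \<le> int N * (int d - 1)"
    and "vanish d N (j + int e) (lform N a ^ e * p)"
  shows "vanish d N j p"
  using assms(2,3)
proof (induction e)
  case (Suc e)
  then show ?case using lform_injective[where N = N and j = "j + int e" and p = "lform N a ^ e * p", OF a]
    by (simp add: algebra_simps)
qed simp

section \<open>The Hilbert function near the middle degree\<close>

lemma small_monoms_0: "small_monoms d 0 j = (if 0 < d \<and> j = 0 then {0} else {})"
  by (auto simp: small_monoms_def mdegree_eq_0_iff)

lemma small_monoms_Suc:
  "small_monoms d (Suc N) j =
     (\<Union>i<d. (\<lambda>m. m + Poly_Mapping.single N i) ` small_monoms d N (j - int i))"
proof (intro equalityI subsetI)
  fix m assume m: "m \<in> small_monoms d (Suc N) j"
  let ?s = "Poly_Mapping.single N (lookup m N)"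
  have eq: "m = (m - ?s) + ?s"
    by (rule poly_mapping_eqI) (simp add: lookup_add lookup_minus lookup_single when_def)
  then have "mdegree m = mdegree (m - ?s) + lookup m N"
    by (metis mdegree_add mdegree_single)
  moreover have "Poly_Mapping.keys (m - ?s) \<subseteq> {..<N}"
  proof
    fix k assume k: "k \<in> Poly_Mapping.keys (m - ?s)"
    then have "k \<noteq> N" "k \<in> Poly_Mapping.keys m"
      by (auto simp: in_keys_iff lookup_minus lookup_single)
    then show "k \<in> {..<N}" using m by (auto simp: small_monoms_def less_Suc_eq)
  qed
  ultimately have "m - ?s \<in> small_monoms d N (j - int (lookup m N))"
    using m by (auto simp: small_monoms_def lookup_minus less_imp_diff_less)
  moreover have "lookup m N < d" using m by (simp add: small_monoms_def)
  ultimately show "m \<in> (\<Union>i<d. (\<lambda>m. m + Poly_Mapping.single N i) ` small_monoms d N (j - int i))"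
    using eq by blast
next
  fix m assume "m \<in> (\<Union>i<d. (\<lambda>m. m + Poly_Mapping.single N i) ` small_monoms d N (j - int i))"
  then obtain i k where ik: "i < d" "k \<in> small_monoms d N (j - int i)" "m = k + Poly_Mapping.single N i"
    by auto
  then have "lookup k N = 0" by (auto simp: small_monoms_def in_keys_iff)
  moreover have "Poly_Mapping.keys m \<subseteq> {..<Suc N}"
    using ik Poly_Mapping.keys_add[of k "Poly_Mapping.single N i"]
    by (fastforce simp: small_monoms_def split: if_splits)
  ultimately show "m \<in> small_monoms d (Suc N) j"
    using ik by (auto simp: small_monoms_def lookup_add lookup_single when_def mdegree_add)
qed

lemma finite_small_monoms [simp]: "finite (small_monoms d N j)"
proof (induction N arbitrary: j)
  case (Suc N)
  show ?case unfolding small_monoms_Suc by (intro finite_UN_I finite_imageI Suc) simp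
qed (simp add: small_monoms_0)

lemma card_small_monoms_Suc:
  "card (small_monoms d (Suc N) j) = (\<Sum>i<d. card (small_monoms d N (j - int i)))"
proof -
  let ?A = "\<lambda>i. (\<lambda>m. m + Poly_Mapping.single N i) ` small_monoms d N (j - int i)"
  have lookup: "lookup m N = i" if "m \<in> ?A i" for m i
    using that by (auto simp: small_monoms_def lookup_add in_keys_iff)
  have "?A i \<inter> ?A k = {}" if "i \<noteq> k" for i k
  proof (rule equals0I)
    fix m assume "m \<in> ?A i \<inter> ?A k"
    then have "lookup m N = i" "lookup m N = k" by (rule lookup[OF IntD1], rule lookup[OF IntD2])
    with that show False by simp
  qed
  then have "card (\<Union>i<d. ?A i) = (\<Sum>i<d. card (?A i))"
    by (intro card_UN_disjoint) simp_all
  also have "\<dots> = (\<Sum>i<d. card (small_monoms d N (j - int i)))"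
    by (intro sum.cong refl card_image) (auto simp: inj_on_def)
  finally show ?thesis by (simp add: small_monoms_Suc)
qed

text \<open>
Adding two variables multiplies the Hilbert series of \<open>B\<close> by \<open>(1 + x + \<dots> + x\<^bsup>d-1\<^esup>)\<^sup>2\<close>; \<open>spread\<close> is the
effect on the coefficients when these are indexed by the distance from the middle degree.
\<close>

definition spread :: "nat \<Rightarrow> (int \<Rightarrow> int) \<Rightarrow> int \<Rightarrow> int" where
  "spread d f j = (\<Sum>i<d. \<Sum>i'<d. f (j + int i - int i'))"

definition central_card :: "nat \<Rightarrow> nat \<Rightarrow> int \<Rightarrow> int" where
  "central_card d k j = int (card (small_monoms d (2 * k) (int k * (int d - 1) + j)))"

lemma central_card_Suc: "central_card d (Suc k) = spread d (central_card d k)"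
proof
  fix j
  let ?c = "\<lambda>s. int (card (small_monoms d (2 * k) s))"
  have "central_card d (Suc k) j = (\<Sum>i<d. \<Sum>i'<d. ?c (int (Suc k) * (int d - 1) + j - int i - int i'))"
    by (simp add: central_card_def card_small_monoms_Suc)
  also have "\<dots> = (\<Sum>i<d. \<Sum>i'<d. ?c (int (Suc k) * (int d - 1) + j - int (d - Suc i) - int i'))"
    by (rule sum.nat_diff_reindex[symmetric])
  also have "\<dots> = spread d (central_card d k) j"
    unfolding spread_def central_card_def
    by (intro sum.cong refl arg_cong[where f = ?c]) (auto simp: algebra_simps of_nat_diff)
  finally show "central_card d (Suc k) j = spread d (central_card d k) j" .
qed

lemma central_card_0: "0 < d \<Longrightarrow> central_card d 0 j = (if j = 0 then 1 else 0)"
  by (simp add: central_card_def small_monoms_0)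

definition peaked :: "(int \<Rightarrow> int) \<Rightarrow> bool" where
  "peaked f \<longleftrightarrow> (\<forall>j. f (- j) = f j) \<and> (\<forall>j\<ge>0. f (j + 1) \<le> f j)"

lemma peakedD:
  assumes "peaked f" "\<bar>x\<bar> \<le> \<bar>y\<bar>"
  shows "f y \<le> f x"
proof -
  have abs: "f \<bar>z\<bar> = f z" for z using assms(1) by (auto simp: peaked_def abs_if)
  have "f (int (a + b)) \<le> f (int a)" for a b
  proof (induction b)
    case (Suc b)
    have "f (int (a + b) + 1) \<le> f (int (a + b))" using assms(1) by (simp only: peaked_def)
    with Suc show ?case by (simp add: add.commute add.left_commute)
  qed simp
  from this[of "nat \<bar>x\<bar>" "nat (\<bar>y\<bar> - \<bar>x\<bar>)"] show ?thesis using assms(2) abs by (simp add: nat_add_distrib[symmetric])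
qed

text \<open>
One of the two sums telescopes, because \<open>(1 - x)(1 + x + \<dots> + x\<^bsup>d-1\<^esup>) = 1 - x\<^sup>d\<close>.
\<close>

lemma spread_step:
  "spread d f j - spread d f (j + 1) = (\<Sum>i<d. f (j - int i) - f (j + int d - int i))"
proof -
  have tel: "(\<Sum>i<n. f (x + int i) - f (x + 1 + int i)) = f x - f (x + int n)" for x n
    by (induction n) (auto simp: algebra_simps)
  have "spread d f j - spread d f (j + 1) =
      (\<Sum>i<d. \<Sum>i'<d. f (j + int i - int i') - f (j + 1 + int i - int i'))"
    by (simp add: spread_def sum_subtractf)
  also have "\<dots> = (\<Sum>i'<d. \<Sum>i<d. f (j + int i - int i') - f (j + 1 + int i - int i'))"
    by (rule sum.swap)
  also have "\<dots> = (\<Sum>i'<d. f (j - int i') - f (j + int d - int i'))"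
    by (intro sum.cong refl) (use tel[of "j - int _"] in \<open>simp add: algebra_simps\<close>)
  finally show ?thesis .
qed

lemma spread_step_reflected:
  "spread d f j - spread d f (j + 1) = (\<Sum>i<d. f (j - int i) - f (j + 1 + int i))"
proof -
  have "(\<Sum>i<d. f (j + int d - int i)) = (\<Sum>i<d. f (j + int d - int (d - Suc i)))"
    by (rule sum.nat_diff_reindex[symmetric])
  also have "\<dots> = (\<Sum>i<d. f (j + 1 + int i))"
    by (intro sum.cong refl arg_cong[where f = f]) (auto simp: of_nat_diff)
  finally show ?thesis by (simp add: spread_step sum_subtractf)
qed

lemma peaked_spread:
  assumes "peaked f"
  shows "peaked (spread d f)"
  unfolding peaked_def
proof (intro conjI allI impI)
  fix j
  have "spread d f (- j) = (\<Sum>i<d. \<Sum>i'<d. f (- (j + int i' - int i)))"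
    by (simp add: spread_def algebra_simps)
  also have "\<dots> = (\<Sum>i<d. \<Sum>i'<d. f (j + int i' - int i))"
    using assms by (simp only: peaked_def)
  also have "\<dots> = spread d f j" unfolding spread_def by (rule sum.swap)
  finally show "spread d f (- j) = spread d f j" .
next
  fix j :: int assume "0 \<le> j"
  then have "0 \<le> (\<Sum>i<d. f (j - int i) - f (j + 1 + int i))"
    by (intro sum_nonneg) (auto intro!: peakedD[OF assms])
  then show "spread d f (j + 1) \<le> spread d f j" using spread_step_reflected[of d f j] by simp
qed

lemma spread_drop_at_0:
  assumes "peaked f"
  shows "spread d f 0 - spread d f 1 = f 0 - f (int d)"
proof -
  have "spread d f 0 - spread d f 1 = (\<Sum>i<d. f (- int i) - f (1 + int i))"
    using spread_step_reflected[of d f 0] by simp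
  also have "\<dots> = (\<Sum>i<d. f (int i) - f (int (Suc i)))"
    using assms by (simp add: peaked_def)
  also have "\<dots> = f 0 - f (int d)" by (induction d) auto
  finally show ?thesis .
qed

lemma spread_drop_at_width:
  "spread d f (int d) - spread d f (int d + 1) = (\<Sum>i<d. f (1 + int i) - f (1 + int i + int d))"
proof -
  have "(\<Sum>i<d. f (int d - int i) - f (int d + int d - int i)) =
      (\<Sum>i<d. f (int d - int (d - Suc i)) - f (int d + int d - int (d - Suc i)))"
    by (rule sum.nat_diff_reindex[symmetric])
  also have "\<dots> = (\<Sum>i<d. f (1 + int i) - f (1 + int i + int d))"
    by (intro sum.cong refl) (auto simp: of_nat_diff algebra_simps)
  finally show ?thesis by (simp add: spread_step)
qed

text \<open>
The drop of the new function at \<open>0\<close> is \<open>f 0 - f d\<close>, and its drop at \<open>d\<close> is a sum of nonnegative terms the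
first of which is \<open>f 1 - f (d + 1)\<close>. The comparison of these two numbers is the hypothesis on \<open>f\<close>.
\<close>

lemma spread_drop_mono:
  assumes "peaked f" "0 < d" "f 0 - f 1 \<le> f (int d) - f (int d + 1)"
  shows "spread d f 0 - spread d f 1 \<le> spread d f (int d) - spread d f (int d + 1)"
proof -
  let ?g = "\<lambda>i. f (1 + int i) - f (1 + int i + int d)"
  have "?g 0 \<le> (\<Sum>i<d. ?g i)"
    using assms(2) by (intro member_le_sum) (auto intro!: peakedD[OF assms(1)])
  moreover have "f 0 - f (int d) \<le> ?g 0" using assms(3) by (simp add: algebra_simps)
  ultimately show ?thesis
    by (simp add: spread_drop_at_0[OF assms(1)] spread_drop_at_width)
qed

text \<open>
When the hypothesis on \<open>f\<close> is weakened by a factor \<open>2\<close>, the second term \<open>f 2 - f (d + 2)\<close> of the drop at \<open>d\<close>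
makes up for the loss.
\<close>

lemma spread_drop_base:
  assumes f: "peaked f" and "2 \<le> d" "f 0 - f 1 \<le> 2 * (f (int d) - f (int d + 1))"
  shows "spread d f 0 - spread d f 1 \<le> spread d f (int d) - spread d f (int d + 1)"
proof -
  let ?g = "\<lambda>i. f (1 + int i) - f (1 + int i + int d)"
  have "(\<Sum>i\<in>{0, 1}. ?g i) \<le> (\<Sum>i<d. ?g i)"
    using assms(2) by (intro sum_mono2) (auto intro!: peakedD[OF f])
  then have "?g 0 + ?g 1 \<le> spread d f (int d) - spread d f (int d + 1)"
    by (simp add: spread_drop_at_width)
  moreover have "f (int d) - f (int d + 1) \<le> ?g 1"
    using assms(2) peakedD[OF f, of 2 "int d"] peakedD[OF f, of "int d + 1" "2 + int d"] by simp
  ultimately show ?thesis using assms(3)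
    by (simp add: spread_drop_at_0[OF f] algebra_simps)
qed

lemma peaked_central_card: "0 < d \<Longrightarrow> peaked (central_card d k)"
proof (induction k)
  case 0 then show ?case by (auto simp: peaked_def central_card_0)
next
  case (Suc k) then show ?case by (simp add: central_card_Suc peaked_spread)
qed

lemma central_card_1:
  assumes "0 < d" "0 \<le> j"
  shows "central_card d 1 j = max 0 (int d - j)"
proof -
  have "(\<Sum>i'<d. if j + int i - int i' = 0 then 1 else (0::int)) = (if j + int i < int d then 1 else 0)" for i
  proof -
    have "j + int i - int i' = 0 \<longleftrightarrow> i' = nat (j + int i)" for i' using assms(2) by auto
    then show ?thesis using assms(2) by (simp add: nat_less_iff)
  qed
  then have "central_card d 1 j = (\<Sum>i<d. if j + int i < int d then 1 else 0)"
    using assms central_card_Suc[of d 0] by (simp add: spread_def central_card_0)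
  also have "\<dots> = int (card {i\<in>{..<d}. j + int i < int d})"
    by (simp add: sum.inter_filter[symmetric])
  also have "{i\<in>{..<d}. j + int i < int d} = {..<nat (int d - j)}" using assms(2) by auto
  finally show ?thesis by auto
qed

text \<open>
The induction over \<open>k\<close> starts at \<open>3\<close>, where \<open>spread_drop_base\<close> applies: for \<open>k = 2\<close> the drops at \<open>0\<close> and at
\<open>d\<close> are \<open>d\<close> and \<open>d(d - 1)/2\<close>, so that the first is at most twice the second.
\<close>

lemma central_card_drop:
  assumes "2 \<le> d" "3 \<le> k"
  shows "central_card d k 0 - central_card d k 1 \<le> central_card d k (int d) - central_card d k (int d + 1)"
  using assms(2)
proof (induction k rule: dec_induct)
  case base
  let ?r = "central_card d 1"
  have pk: "peaked (central_card d k)" for k using peaked_central_card assms(1) by simp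
  have "(\<Sum>i<d. ?r (1 + int i) - ?r (1 + int i + int d)) = (\<Sum>i<d. int d - 1 - int i)"
    using assms(1) by (intro sum.cong refl) (simp add: central_card_1[unfolded One_nat_def])
  moreover have "2 * (\<Sum>i<d. int n - 1 - int i) = int d * (2 * int n - int d - 1)" for n
    by (induction d) (auto simp: algebra_simps)
  moreover have "int d * (2 * int d - int d - 1) \<ge> int d * 1"
    using assms(1) by (intro mult_left_mono) auto
  moreover have "?r 0 - ?r (int d) = int d" using assms(1) by (simp add: central_card_1[unfolded One_nat_def])
  ultimately have "spread d ?r 0 - spread d ?r 1 \<le> 2 * (spread d ?r (int d) - spread d ?r (int d + 1))"
    by (simp add: spread_drop_at_0[OF pk] spread_drop_at_width)
  then have "central_card d 2 0 - central_card d 2 1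
      \<le> 2 * (central_card d 2 (int d) - central_card d 2 (int d + 1))"
    by (simp add: central_card_Suc[symmetric] numeral_2_eq_2)
  from spread_drop_base[OF pk assms(1) this] show ?case
    by (simp add: central_card_Suc[symmetric] numeral_3_eq_3 numeral_2_eq_2)
next
  case (step k)
  then show ?case using spread_drop_mono[OF peaked_central_card] assms(1)
    by (simp add: central_card_Suc)
qed

text \<open>
Since \<open>L\<^sup>d\<close> is injective up to the middle degree \<open>t\<close> of \<open>B\<close>, this says that
\<open>dim [A]\<^sub>t \<le> dim [A]\<^bsub>t-1\<^esub>\<close> for \<open>A = B/(L\<^sup>d)\<close>.
\<close>

lemma card_small_monoms_ineq:
  assumes "2 \<le> d" "3 \<le> n"
  defines "t \<equiv> int n * (int d - 1)"
  shows "card (small_monoms d (2 * n) t) + card (small_monoms d (2 * n) (t - 1 - int d))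
      \<le> card (small_monoms d (2 * n) (t - 1)) + card (small_monoms d (2 * n) (t - int d))"
proof -
  have c: "central_card d n j = central_card d n (- j)" for j
    using peaked_central_card[of d n] assms(1) by (simp add: peaked_def)
  show ?thesis
    using central_card_drop[OF assms(1,2)]
    unfolding c[of 1] c[of "int d"] c[of "int d + 1"]
    by (simp add: central_card_def t_def algebra_simps)
qed

section \<open>Differential operators and the apolar pairing\<close>

definition partial :: "nat \<Rightarrow> 'a::comm_semiring_1 \<Rightarrow> 'a mpoly \<Rightarrow> 'a mpoly" where
  "partial i c = lower i (\<lambda>m. c * of_nat (lookup m i + 1))"

lemma partial_add: "partial i c (p + q) = partial i c p + partial i c q"
  by (rule poly_mapping_eqI) (simp add: partial_def lookup_lower lookup_add algebra_simps)

lemma partial_single: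
  "partial i c (Poly_Mapping.single m b) = Poly_Mapping.single (m - evar i) (c * of_nat (lookup m i) * b)"
proof (rule poly_mapping_eqI)
  fix k
  show "lookup (partial i c (Poly_Mapping.single m b)) k =
      lookup (Poly_Mapping.single (m - evar i) (c * of_nat (lookup m i) * b)) k"
  proof (cases "m = k + evar i")
    case True
    then show ?thesis by (simp add: partial_def lookup_lower lookup_add lookup_evar)
  next
    case False
    then have "lookup m i = 0 \<or> m - evar i \<noteq> k"
      using minus_evar_plus_evar by metis
    with False show ?thesis by (auto simp: partial_def lookup_lower lookup_single when_def)
  qed
qed

lemma partial_mult: "partial i c (p * q) = partial i c p * q + p * partial i c q"
proof (induction p rule: mpoly_induct)
  case (single m a)
  show ?case
  proof (induction q rule: mpoly_induct)
    case (single k b)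
    have 1: "m + k - evar i = m - evar i + k" if "lookup m i \<noteq> 0"
      using that by (auto simp: poly_mapping_eq_iff fun_eq_iff lookup_add lookup_minus lookup_evar)
    have 2: "m + k - evar i = m + (k - evar i)" if "lookup k i \<noteq> 0"
      using that by (auto simp: poly_mapping_eq_iff fun_eq_iff lookup_add lookup_minus lookup_evar)
    have "Poly_Mapping.single (m + k - evar i) (c * of_nat (lookup m i) * (a * b)) =
        Poly_Mapping.single (m - evar i + k) (c * of_nat (lookup m i) * (a * b))"
      by (cases "lookup m i = 0") (simp_all add: 1)
    moreover have "Poly_Mapping.single (m + k - evar i) (c * of_nat (lookup k i) * (a * b)) =
        Poly_Mapping.single (m + (k - evar i)) (c * of_nat (lookup k i) * (a * b))"
      by (cases "lookup k i = 0") (simp_all add: 2)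
    ultimately show ?case
      by (simp add: partial_single mult_single lookup_add single_add[symmetric] algebra_simps)
         (simp add: single_add add.commute)
  qed (simp add: partial_add algebra_simps)
qed (simp add: partial_add algebra_simps)

definition dderiv :: "nat \<Rightarrow> (nat \<Rightarrow> 'a::comm_semiring_1) \<Rightarrow> 'a mpoly \<Rightarrow> 'a mpoly" where
  "dderiv N c p = (\<Sum>i<N. partial i (c i) p)"

lemma dderiv_add: "dderiv N c (p + q) = dderiv N c p + dderiv N c q"
  by (simp add: dderiv_def partial_add sum.distrib)

lemma dderiv_mult: "dderiv N c (p * q) = dderiv N c p * q + p * dderiv N c q"
  by (simp add: dderiv_def partial_mult sum.distrib sum_distrib_left sum_distrib_right)

text \<open>
By the Leibniz rule every term \<open>D\<^sup>i f \<cdot> D\<^sup>j g\<close> of \<open>D\<^bsup>a+b+1\<^esup>(f g)\<close> has \<open>i > a\<close> or \<open>j > b\<close>.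
\<close>

lemma derivation_nilpotent_mult:
  fixes D :: "'r::comm_ring_1 \<Rightarrow> 'r"
  assumes add: "\<And>p q. D (p + q) = D p + D q" and mult: "\<And>p q. D (p * q) = D p * q + p * D q"
    and "(D ^^ Suc a) f = 0" "(D ^^ Suc b) g = 0"
  shows "(D ^^ Suc (a + b)) (f * g) = 0"
proof -
  have D0: "D 0 = 0" using add[of 0 0] by simp
  have pow0: "(D ^^ k) 0 = 0" for k by (induction k) (auto simp: D0)
  have powadd: "(D ^^ k) (p + q) = (D ^^ k) p + (D ^^ k) q" for k p q
    by (induction k) (auto simp: add)
  show ?thesis using assms(3,4)
  proof (induction "a + b" arbitrary: a b f g)
    case 0
    then show ?case by (simp add: mult)
  next
    case (Suc n)
    have "(D ^^ (a + b)) (D f * g) = 0"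
    proof (cases a)
      case 0
      then show ?thesis using Suc.prems(1) pow0 by simp
    next
      case (Suc a')
      then show ?thesis using Suc.hyps(1)[of a' b "D f" g] Suc.hyps(2) Suc.prems
        by (simp add: funpow_swap1)
    qed
    moreover have "(D ^^ (a + b)) (f * D g) = 0"
    proof (cases b)
      case 0
      then show ?thesis using Suc.prems(2) pow0 by simp
    next
      case (Suc b')
      then show ?thesis using Suc.hyps(1)[of a b' f "D g"] Suc.hyps(2) Suc.prems
        by (simp add: funpow_swap1)
    qed
    ultimately show ?case by (simp add: funpow_Suc_right mult powadd del: funpow.simps)
  qed
qed

lemma derivation_nilpotent_power:
  fixes D :: "'r::comm_ring_1 \<Rightarrow> 'r"
  assumes add: "\<And>p q. D (p + q) = D p + D q" and mult: "\<And>p q. D (p * q) = D p * q + p * D q"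
    and "(D ^^ Suc a) f = 0"
  shows "(D ^^ Suc (a * k)) (f ^ k) = 0"
proof (induction k)
  case 0
  then show ?case using mult[of 1 1] by simp
next
  case (Suc k)
  have "(D ^^ Suc (a + a * k)) (f * f ^ k) = 0"
    by (rule derivation_nilpotent_mult) (fact assms Suc)+
  then show ?case by simp
qed

definition mfact :: "(nat \<Rightarrow>\<^sub>0 nat) \<Rightarrow> 'a::comm_semiring_1" where
  "mfact m = (\<Prod>i\<in>Poly_Mapping.keys m. of_nat (fact (lookup m i)))"

lemma mfact_eq_prod:
  assumes "Poly_Mapping.keys m \<subseteq> A" "finite A"
  shows "mfact m = (\<Prod>i\<in>A. of_nat (fact (lookup m i)))"
  unfolding mfact_def
  by (rule prod.mono_neutral_left) (use assms in \<open>auto simp: in_keys_iff\<close>)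

lemma mfact_minus_evar:
  assumes "lookup m i \<noteq> 0"
  shows "(mfact m :: 'a::comm_semiring_1) = of_nat (lookup m i) * mfact (m - evar i)"
proof -
  let ?A = "Poly_Mapping.keys m"
  have i: "i \<in> ?A" using assms by (simp add: in_keys_iff)
  have "Poly_Mapping.keys (m - evar i) \<subseteq> ?A" by (auto simp: in_keys_iff lookup_minus)
  then have "mfact (m - evar i) = (\<Prod>k\<in>?A. of_nat (fact (lookup (m - evar i) k)) :: 'a)"
    by (simp add: mfact_eq_prod)
  also have "\<dots> = of_nat (fact (lookup m i - 1)) * (\<Prod>k\<in>?A - {i}. of_nat (fact (lookup m k)))"
    using i by (simp add: prod.remove[of _ i] lookup_minus lookup_evar)
  finally have *: "mfact (m - evar i) =
      of_nat (fact (lookup m i - 1)) * (\<Prod>k\<in>?A - {i}. of_nat (fact (lookup m k)) :: 'a)" .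
  have "fact (lookup m i) = lookup m i * fact (lookup m i - 1)"
    using assms by (simp add: fact_reduce)
  moreover have "mfact m = of_nat (fact (lookup m i)) * (\<Prod>k\<in>?A - {i}. of_nat (fact (lookup m k)) :: 'a)"
    unfolding mfact_def by (rule prod.remove[OF finite_keys i])
  ultimately show ?thesis unfolding * by (simp only: of_nat_mult mult.assoc)
qed

lemma mfact_nonzero: "mfact m \<noteq> (0 :: 'a::field_char_0)"
  by (simp add: mfact_def)

text \<open>
The apolar pairing: the constant term of \<open>u(\<partial>) G\<close>. The monomials are orthogonal, and the square of \<open>x\<^sup>m\<close> is
\<open>m! = \<Prod>m\<^sub>i!\<close>, so that multiplication by \<open>x\<^sub>i\<close> is adjoint to the derivative \<open>\<partial>\<^sub>i\<close>.
\<close>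

definition apolar :: "'a::comm_semiring_1 mpoly \<Rightarrow> 'a mpoly \<Rightarrow> 'a" where
  "apolar u G = (\<Sum>m\<in>Poly_Mapping.keys G. mfact m * lookup u m * lookup G m)"

lemma apolar_eq_sum:
  assumes "Poly_Mapping.keys G \<subseteq> A" "finite A"
  shows "apolar u G = (\<Sum>m\<in>A. mfact m * lookup u m * lookup G m)"
  unfolding apolar_def
  by (rule sum.mono_neutral_left) (use assms in \<open>auto simp: in_keys_iff\<close>)

lemma apolar_add_right: "apolar u (G + G') = apolar u G + apolar u G'"
proof -
  let ?A = "Poly_Mapping.keys G \<union> Poly_Mapping.keys G'"
  have "Poly_Mapping.keys (G + G') \<subseteq> ?A" by (rule Poly_Mapping.keys_add)
  then show ?thesis
    by (subst (1 2 3) apolar_eq_sum[where A = ?A])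
       (auto simp: lookup_add distrib_left sum.distrib)
qed

lemma apolar_zero_right [simp]: "apolar u 0 = 0"
  by (simp add: apolar_def)

lemma apolar_sum_right: "apolar u (\<Sum>i\<in>A. G i) = (\<Sum>i\<in>A. apolar u (G i))"
  by (induction A rule: infinite_finite_induct) (auto simp: apolar_add_right)

lemma apolar_add_left: "apolar (u + v) G = apolar u G + apolar v G"
  by (simp add: apolar_def lookup_add algebra_simps sum.distrib)

lemma apolar_zero_left [simp]: "apolar 0 G = 0"
  by (simp add: apolar_def)

lemma apolar_sum_left: "apolar (\<Sum>i\<in>A. u i) G = (\<Sum>i\<in>A. apolar (u i) G)"
  by (induction A rule: infinite_finite_induct) (auto simp: apolar_add_left)

lemma apolar_single_right: "apolar u (Poly_Mapping.single m b) = mfact m * lookup u m * b"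
  by (simp add: apolar_def)

lemma apolar_var_times:
  "apolar (Poly_Mapping.single (evar i) c * u) G = apolar u (partial i c G)"
proof (induction G rule: mpoly_induct)
  case (single m b)
  show ?case unfolding apolar_single_right partial_single lookup_var_times
    by (cases "lookup m i = 0") (auto simp: mfact_minus_evar algebra_simps)
qed (simp add: apolar_add_right partial_add)

lemma apolar_lform_times: "apolar (lform N c * u) G = apolar u (dderiv N c G)"
  by (simp add: lform_def dderiv_def sum_distrib_right apolar_sum_left apolar_sum_right apolar_var_times)

lemma apolar_lform_power_times: "apolar (lform N c ^ e * u) G = apolar u ((dderiv N c ^^ e) G)"
proof (induction e arbitrary: G)
  case (Suc e)
  have "apolar (lform N c ^ Suc e * u) G = apolar (lform N c ^ e * u) (dderiv N c G)"
    by (simp add: mult.assoc apolar_lform_times)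
  then show ?case by (simp add: Suc funpow_swap1)
qed simp

section \<open>The dual generator\<close>

text \<open>
The left-hand side is the coefficient of \<open>x\<^bsup>card A-1\<^esup>\<close> in the Lagrange interpolation of \<open>Q\<close> at the points
\<open>s i\<close>, which is \<open>Q\<close> itself for reasons of degree.
\<close>

lemma divided_difference:
  fixes Q :: "'a::field poly"
  assumes A: "finite A" "inj_on s A" and Q: "degree Q < card A"
  shows "(\<Sum>i\<in>A. poly Q (s i) / (\<Prod>j\<in>A - {i}. s i - s j)) = coeff Q (card A - 1)"
proof -
  define den where "den i = (\<Prod>j\<in>A - {i}. s i - s j)" for i
  define B where "B i = (\<Prod>j\<in>A - {i}. [:- s j, 1:])" for i
  define P where "P = (\<Sum>i\<in>A. smult (poly Q (s i) / den i) (B i))"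
  have monic: "degree (\<Prod>j\<in>X. [:- s j, 1:]) = card X \<and> lead_coeff (\<Prod>j\<in>X. [:- s j, 1:]) = 1"
    if "finite X" for X
  proof
    show "degree (\<Prod>j\<in>X. [:- s j, 1:]) = card X" by (simp add: degree_prod_eq_sum_degree)
    show "lead_coeff (\<Prod>j\<in>X. [:- s j, 1:]) = 1" unfolding lead_coeff_prod by simp
  qed
  have B: "degree (B i) = card A - 1" "coeff (B i) (card A - 1) = 1" if "i \<in> A" for i
    using monic[of "A - {i}"] A(1) that by (auto simp: B_def)
  have den: "den i \<noteq> 0" if "i \<in> A" for i
    using that A by (auto simp: den_def inj_on_def)
  have ev: "poly (B i) (s k) = (if i = k then den k else 0)" if "i \<in> A" "k \<in> A" for i k
    using that A(1) by (auto simp: B_def den_def poly_prod)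
  have "P = Q"
  proof (rule poly_eqI_degree)
    fix x assume "x \<in> s ` A"
    then obtain k where k: "k \<in> A" "x = s k" by auto
    have "poly P x = (\<Sum>i\<in>A. if i = k then poly Q (s k) else 0)"
      unfolding P_def poly_sum k(2)
      by (intro sum.cong refl) (use den in \<open>simp add: ev k(1)\<close>)
    then show "poly P x = poly Q x" using k A(1) by simp
  next
    have "degree P \<le> card A - 1" unfolding P_def
      by (intro degree_sum_le) (auto simp: A B intro: le_trans[OF degree_smult_le])
    then show "degree P < card (s ` A)" using Q by (simp add: card_image A)
    show "degree Q < card (s ` A)" using Q by (simp add: card_image A)
  qed
  moreover have "coeff P (card A - 1) = (\<Sum>i\<in>A. poly Q (s i) / den i)"
    by (simp add: P_def coeff_sum B[unfolded One_nat_def])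
  ultimately show ?thesis by (simp add: den_def)
qed

definition ind_monom :: "nat set \<Rightarrow> nat \<Rightarrow>\<^sub>0 nat" where
  "ind_monom S = (\<Sum>i\<in>S. evar i)"

lemma lookup_ind_monom: "finite S \<Longrightarrow> lookup (ind_monom S) i = (if i \<in> S then 1 else 0)"
  by (simp add: ind_monom_def lookup_sum lookup_evar)

definition sqfree_form :: "nat \<Rightarrow> nat \<Rightarrow> (nat set \<Rightarrow> 'a::comm_semiring_1) \<Rightarrow> 'a mpoly" where
  "sqfree_form N k c = (\<Sum>S | S \<subseteq> {..<N} \<and> card S = k. Poly_Mapping.single (ind_monom S) (c S))"

lemma finite_subsets_card [simp]: "finite {S. S \<subseteq> {..<N::nat} \<and> card S = k}"
  by (rule finite_subset[of _ "Pow {..<N}"]) auto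

lemma dderiv_sum: "dderiv N b (\<Sum>i\<in>A. p i) = (\<Sum>i\<in>A. dderiv N b (p i))"
proof (induction A rule: infinite_finite_induct)
  case empty
  show ?case by (rule poly_mapping_eqI) (simp add: dderiv_def partial_def lookup_sum lookup_lower)
next
  case (infinite A)
  show ?case using infinite by (intro poly_mapping_eqI) (simp add: dderiv_def partial_def lookup_sum lookup_lower)
qed (simp_all add: dderiv_add)

text \<open>
The derivative of \<open>\<Prod>\<^bsub>j\<in>S\<^esub> x\<^sub>j\<close> by \<open>x\<^sub>i\<close> is the product over \<open>T = S - {i}\<close>; the sum over the pairs
\<open>i \<in> S\<close> is rearranged as a sum over the pairs \<open>i \<notin> T\<close>.
\<close>

lemma dderiv_sqfree_form:
  "dderiv N b (sqfree_form N (Suc k) c) =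
     sqfree_form N k (\<lambda>T. \<Sum>i\<in>{..<N} - T. b i * c (insert i T))"
proof -
  let ?P = "\<lambda>k. {S. S \<subseteq> {..<N} \<and> card S = k}"
  have fin: "finite S" if "S \<subseteq> {..<N}" for S using that finite_subset by blast
  have single: "partial i (b i) (Poly_Mapping.single (ind_monom S) (c S)) =
      (if i \<in> S then Poly_Mapping.single (ind_monom (S - {i})) (b i * c S) else 0)" if "finite S" for i S
  proof -
    have "ind_monom S - evar i = ind_monom (S - {i})" if i: "i \<in> S"
    proof (rule poly_mapping_eqI)
      fix k
      have "lookup (ind_monom S - evar i) k = lookup (ind_monom S) k - lookup (evar i) k"
        by (rule lookup_minus)
      also have "\<dots> = lookup (ind_monom (S - {i})) k"
        unfolding lookup_evar lookup_ind_monom[OF \<open>finite S\<close>] lookup_ind_monom[OF finite_Diff[OF \<open>finite S\<close>]]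
        by (cases "k = i"; cases "k \<in> S") (simp_all add: i)
      finally show "lookup (ind_monom S - evar i) k = lookup (ind_monom (S - {i})) k" .
    qed
    then show ?thesis using that by (simp add: partial_single lookup_ind_monom)
  qed
  have "dderiv N b (sqfree_form N (Suc k) c) =
      (\<Sum>S\<in>?P (Suc k). \<Sum>i<N. if i \<in> S then Poly_Mapping.single (ind_monom (S - {i})) (b i * c S) else 0)"
    unfolding sqfree_form_def dderiv_sum by (intro sum.cong refl) (simp add: dderiv_def single fin)
  also have "\<dots> = (\<Sum>S\<in>?P (Suc k). \<Sum>i\<in>S. Poly_Mapping.single (ind_monom (S - {i})) (b i * c S))"
    by (intro sum.cong refl sum.mono_neutral_cong_right) auto
  also have "\<dots> = (\<Sum>(S, i)\<in>Sigma (?P (Suc k)) (\<lambda>S. S). Poly_Mapping.single (ind_monom (S - {i})) (b i * c S))"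
    by (rule sum.Sigma) (auto intro: fin)
  also have "\<dots> = (\<Sum>(T, i)\<in>Sigma (?P k) (\<lambda>T. {..<N} - T). Poly_Mapping.single (ind_monom T) (b i * c (insert i T)))"
  proof (rule sum.reindex_bij_witness[where i = "\<lambda>(T, i). (insert i T, i)" and j = "\<lambda>(S, i). (S - {i}, i)"], goal_cases)
    case (1 Si)
    then show ?case by (auto simp: insert_absorb)
  next
    case (2 Si)
    then show ?case by (auto simp: card_Diff_singleton)
  next
    case (3 Ti)
    then show ?case by auto
  next
    case (4 Ti)
    then obtain T i where "Ti = (T, i)" "T \<subseteq> {..<N}" "card T = k" "i < N" "i \<notin> T" by auto
    then show ?case using fin[of T] by simp
  next
    case (5 Si)
    then show ?case by (auto simp: insert_absorb)
  qed
  also have "\<dots> = (\<Sum>T\<in>?P k. \<Sum>i\<in>{..<N} - T. Poly_Mapping.single (ind_monom T) (b i * c (insert i T)))"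
    by (rule sum.Sigma[symmetric]) auto
  also have "\<dots> = sqfree_form N k (\<lambda>T. \<Sum>i\<in>{..<N} - T. b i * c (insert i T))"
  proof -
    have "Poly_Mapping.single m (\<Sum>i\<in>A. f i) = (\<Sum>i\<in>A. Poly_Mapping.single m (f i))"
      for m :: "nat \<Rightarrow>\<^sub>0 nat" and f :: "nat \<Rightarrow> 'a" and A
      by (induction A rule: infinite_finite_induct) (auto simp: single_add)
    then show ?thesis by (simp add: sqfree_form_def)
  qed
  finally show ?thesis .
qed

text \<open>
By the Cauchy-Binet formula this is, up to sign, the coefficient of \<open>\<Prod>\<^bsub>i\<in>S\<^esub> x\<^sub>i\<close> in \<open>det (\<Sum>w\<^sub>i x\<^sub>i v\<^sub>i v\<^sub>i\<^sup>T)\<close>, where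
\<open>v\<^sub>i = (1, s\<^sub>i, \<dots>, s\<^sub>i\<^bsup>n-1\<^esup>)\<close>, \<open>n = card S\<close>, and \<open>w\<^sub>i\<close> is the inverse in the first product. The product over ordered pairs
is the squared Vandermonde determinant up to a sign that depends only on \<open>card S\<close>. The \<open>w\<^sub>i\<close> are chosen
such that \<open>b\<^sub>i w\<^sub>i\<close> are the weights of Lagrange interpolation.
\<close>

definition vandermonde_weight :: "nat \<Rightarrow> (nat \<Rightarrow> 'a::field) \<Rightarrow> (nat \<Rightarrow> 'a) \<Rightarrow> nat set \<Rightarrow> 'a" where
  "vandermonde_weight N b s S =
     (\<Prod>i\<in>S. inverse (b i * (\<Prod>j\<in>{..<N} - {i}. s i - s j))) * (\<Prod>i\<in>S. \<Prod>j\<in>S - {i}. s i - s j)"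

text \<open>
Up to sign, adding \<open>i\<close> to \<open>T\<close> multiplies the squared Vandermonde determinant by the value at \<open>s i\<close> of
\<open>\<Prod>\<^bsub>j\<in>T\<^esub> (x - s\<^sub>j)\<^sup>2\<close>; the sign is the one that belongs to products over ordered pairs.
\<close>

definition weight_poly :: "(nat \<Rightarrow> 'a::comm_ring_1) \<Rightarrow> nat set \<Rightarrow> 'a poly" where
  "weight_poly s T = (\<Prod>j\<in>T. [:- s j, 1:] * [:s j, -1:])"

lemma poly_weight_poly: "poly (weight_poly s T) x = (\<Prod>j\<in>T. x - s j) * (\<Prod>j\<in>T. s j - x)"
  by (simp add: weight_poly_def poly_prod prod.distrib[symmetric] algebra_simps)

lemma weight_poly_degree:
  fixes s :: "nat \<Rightarrow> 'a::field"
  assumes "finite T"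
  shows "degree (weight_poly s T) = 2 * card T" "coeff (weight_poly s T) (2 * card T) = (-1) ^ card T"
proof -
  have 1: "degree ([:- s j, 1:] * [:s j, -1:]) = 2" "lead_coeff ([:- s j, 1:] * [:s j, -1:]) = -1" for j
    by (simp_all add: degree_mult_eq)
  show d: "degree (weight_poly s T) = 2 * card T"
    unfolding weight_poly_def by (subst degree_prod_eq_sum_degree) (simp_all only: 1, simp_all)
  have "lead_coeff (weight_poly s T) = (-1) ^ card T"
    unfolding weight_poly_def lead_coeff_prod 1(2) by simp
  then show "coeff (weight_poly s T) (2 * card T) = (-1) ^ card T" by (simp add: d)
qed

lemma vandermonde_weight_insert:
  assumes "finite T" "i \<notin> T"
  shows "vandermonde_weight N b s (insert i T) =
           vandermonde_weight N b s T * poly (weight_poly s T) (s i) /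
             (b i * (\<Prod>j\<in>{..<N} - {i}. s i - s j))"
proof -
  have "(\<Prod>x\<in>T. \<Prod>j\<in>insert i T - {x}. s x - s j) = (\<Prod>x\<in>T. (s x - s i) * (\<Prod>j\<in>T - {x}. s x - s j))"
  proof (intro prod.cong refl)
    fix x assume "x \<in> T"
    then have "insert i T - {x} = insert i (T - {x})" using assms(2) by auto
    then show "(\<Prod>j\<in>insert i T - {x}. s x - s j) = (s x - s i) * (\<Prod>j\<in>T - {x}. s x - s j)"
      using assms by simp
  qed
  also have "\<dots> = (\<Prod>x\<in>T. s x - s i) * (\<Prod>x\<in>T. \<Prod>j\<in>T - {x}. s x - s j)"
    by (rule prod.distrib)
  finally have "(\<Prod>x\<in>T. \<Prod>j\<in>insert i T - {x}. s x - s j) = \<dots>" .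
  moreover have "insert i T - {i} = T" using assms(2) by auto
  ultimately show ?thesis using assms
    by (simp add: vandermonde_weight_def poly_weight_poly divide_inverse mult_ac)
qed

text \<open>
The terms are values of one polynomial at the points \<open>s i\<close> with the weights of Lagrange interpolation,
and the polynomial vanishes at the points that belong to \<open>T\<close>, so \<open>divided_difference\<close> applies. For
\<open>e = 0\<close> and \<open>e = 1\<close> the coefficients \<open>b\<^sub>i s\<^sub>i\<^sup>e\<close> are those of the two linear forms.
\<close>

lemma vandermonde_weight_sum:
  assumes s: "inj_on s {..<N}" and b: "\<And>i. i < N \<Longrightarrow> b i \<noteq> 0"
    and T: "T \<subseteq> {..<N}" and e: "2 * card T + e < N"
  shows "(\<Sum>i\<in>{..<N} - T. b i * s i ^ e * vandermonde_weight N b s (insert i T)) =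
           vandermonde_weight N b s T * coeff (monom 1 e * weight_poly s T) (N - 1)"
proof -
  let ?Q = "monom 1 e * weight_poly s T"
  have fin: "finite T" using T finite_subset by blast
  have "(\<Sum>i\<in>{..<N} - T. b i * s i ^ e * vandermonde_weight N b s (insert i T)) =
      (\<Sum>i\<in>{..<N} - T. vandermonde_weight N b s T * (poly ?Q (s i) / (\<Prod>j\<in>{..<N} - {i}. s i - s j)))"
    using b fin by (intro sum.cong refl) (simp add: vandermonde_weight_insert poly_monom)
  also have "\<dots> = (\<Sum>i<N. vandermonde_weight N b s T * (poly ?Q (s i) / (\<Prod>j\<in>{..<N} - {i}. s i - s j)))"
    using T fin by (intro sum.mono_neutral_left) (auto simp: poly_weight_poly)
  also have "\<dots> = vandermonde_weight N b s T * (\<Sum>i<N. poly ?Q (s i) / (\<Prod>j\<in>{..<N} - {i}. s i - s j))"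
    by (rule sum_distrib_left[symmetric])
  also have "(\<Sum>i<N. poly ?Q (s i) / (\<Prod>j\<in>{..<N} - {i}. s i - s j)) = coeff ?Q (card {..<N} - 1)"
  proof (rule divided_difference)
    have "degree ?Q \<le> e + 2 * card T"
      using degree_mult_le[of "monom 1 e" "weight_poly s T"] degree_monom_le[of "1::'a" e]
      by (simp add: weight_poly_degree fin)
    then show "degree ?Q < card {..<N}" using e by simp
  qed (use s in auto)
  finally show ?thesis by simp
qed

lemma vandermonde_weight_nonzero:
  assumes "inj_on s {..<N}" "\<And>i. i < N \<Longrightarrow> b i \<noteq> 0" "S \<subseteq> {..<N}"
  shows "vandermonde_weight N b s S \<noteq> 0"
proof -
  have "finite S" using assms(3) finite_subset by blast
  with assms show ?thesis by (auto simp: vandermonde_weight_def inj_on_def subset_iff)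
qed

lemma sqfree_form_cong:
  "(\<And>S. S \<subseteq> {..<N} \<Longrightarrow> card S = k \<Longrightarrow> c S = c' S) \<Longrightarrow> sqfree_form N k c = sqfree_form N k c'"
  unfolding sqfree_form_def by (intro sum.cong refl) simp

lemma sqfree_form_zero [simp]: "sqfree_form N k (\<lambda>S. 0) = 0"
  by (simp add: sqfree_form_def)

lemma lookup_sqfree_form_ind_monom:
  assumes "S \<subseteq> {..<N}" "card S = k"
  shows "lookup (sqfree_form N k c) (ind_monom S) = c S"
proof -
  have inj: "ind_monom S' = ind_monom S \<longleftrightarrow> S' = S" if "S' \<subseteq> {..<N}" for S'
  proof
    assume eq: "ind_monom S' = ind_monom S"
    have "finite S'" "finite S" using that assms(1) finite_subset by blast+
    then have "i \<in> S' \<longleftrightarrow> i \<in> S" for i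
      using arg_cong[OF eq, of "\<lambda>m. lookup m i"] by (simp add: lookup_ind_monom split: if_splits)
    then show "S' = S" by blast
  qed simp
  have "lookup (sqfree_form N k c) (ind_monom S) =
      (\<Sum>S' | S' \<subseteq> {..<N} \<and> card S' = k. if S' = S then c S else 0)"
    unfolding sqfree_form_def lookup_sum
    by (intro sum.cong refl) (auto simp: lookup_single inj when_def)
  then show ?thesis using assms by simp
qed

lemma keys_sqfree_form:
  assumes "m \<in> Poly_Mapping.keys (sqfree_form N k c)"
  shows "Poly_Mapping.keys m \<subseteq> {..<N} \<and> (\<forall>i. lookup m i \<le> 1) \<and> mdegree m = k"
proof -
  have "m \<in> (\<Union>S\<in>{S. S \<subseteq> {..<N} \<and> card S = k}. Poly_Mapping.keys (Poly_Mapping.single (ind_monom S) (c S)))"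
    by (rule subsetD[OF Poly_Mapping.keys_sum assms[unfolded sqfree_form_def]])
  then obtain S where S: "S \<subseteq> {..<N}" "card S = k" "m = ind_monom S"
    by (auto split: if_splits)
  have fin: "finite S" using S(1) finite_subset by blast
  have keys: "Poly_Mapping.keys m \<subseteq> {..<N}"
    using S fin by (auto simp: in_keys_iff lookup_ind_monom split: if_splits)
  have "mdegree m = (\<Sum>i<N. if i \<in> S then 1 else 0)"
    unfolding mdegree_eq_sum[OF keys finite_lessThan] by (simp add: S(3) lookup_ind_monom fin)
  also have "\<dots> = card ({..<N} \<inter> S)" by (simp add: sum.If_cases)
  also have "{..<N} \<inter> S = S" using S(1) by auto
  finally show ?thesis using keys S fin by (simp add: lookup_ind_monom)
qed

lemma keys_power_bound:
  assumes "\<And>m. m \<in> Poly_Mapping.keys f \<Longrightarrow>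
      Poly_Mapping.keys m \<subseteq> A \<and> (\<forall>i. lookup m i \<le> 1) \<and> mdegree m = k"
  shows "m \<in> Poly_Mapping.keys (f ^ e) \<Longrightarrow>
      Poly_Mapping.keys m \<subseteq> A \<and> (\<forall>i. lookup m i \<le> e) \<and> mdegree m = k * e"
proof (induction e arbitrary: m)
  case 0
  then show ?case by (simp add: mdegree_eq_0_iff)
next
  case (Suc e)
  then obtain x y where xy: "m = x + y" "x \<in> Poly_Mapping.keys f" "y \<in> Poly_Mapping.keys (f ^ e)"
    using keys_mult[of f "f ^ e"] by auto
  have "lookup m i \<le> Suc e" for i
    using assms[OF xy(2)] Suc.IH[OF xy(3)] add_mono[of "lookup x i" 1 "lookup y i" e]
    by (simp add: xy(1) lookup_add)
  moreover have "Poly_Mapping.keys m \<subseteq> A"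
    using assms[OF xy(2)] Suc.IH[OF xy(3)] Poly_Mapping.keys_add[of x y] xy(1) by blast
  ultimately show ?case
    using assms[OF xy(2)] Suc.IH[OF xy(3)] by (simp add: xy(1) mdegree_add)
qed

text \<open>
Let \<open>c\<^sub>S\<close> be the weight of \<open>S\<close> and \<open>H\<^sub>k = \<Sum>c\<^sub>S \<Prod>\<^bsub>i\<in>S\<^esub> x\<^sub>i\<close>, summed over the \<open>k\<close>-subsets \<open>S\<close>. The interpolation
polynomials that compute \<open>l(\<partial>)H\<^sub>n\<close>, \<open>L(\<partial>)H\<^sub>n\<close> and \<open>L(\<partial>)H\<^bsub>n-1\<^esub>\<close> have degrees \<open>2n - 2\<close>, \<open>2n - 1\<close> and
\<open>2n - 3\<close>, and only the coefficient of degree \<open>2n - 1\<close> contributes. Hence \<open>l(\<partial>)H\<^sub>n = 0\<close>,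
\<open>L(\<partial>)H\<^sub>n = \<plusminus>H\<^bsub>n-1\<^esub>\<close> and \<open>L(\<partial>)\<^sup>2H\<^sub>n = 0\<close>, and \<open>H\<^sub>n\<^bsup>d-1\<^esup>\<close> is the form sought.
\<close>

lemma dual_generator_exists:
  fixes a b :: "nat \<Rightarrow> 'a::field_char_0"
  assumes n: "2 \<le> n" and d: "1 \<le> d"
    and b: "\<And>i. i < 2 * n \<Longrightarrow> b i \<noteq> 0"
    and s: "inj_on (\<lambda>i. a i / b i) {..<2 * n}"
  obtains G where "G \<noteq> 0" "Poly_Mapping.keys G \<subseteq> small_monoms d (2 * n) (int n * (int d - 1))"
    "dderiv (2 * n) b G = 0" "(dderiv (2 * n) a ^^ d) G = 0"
proof -
  let ?N = "2 * n"
  define s where "s i = a i / b i" for i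
  note inj = s[folded s_def]
  define c where "c = vandermonde_weight ?N b s"
  define H where "H = sqfree_form ?N n c"
  obtain n' where n': "n = Suc (Suc n')" using n by (metis Suc_le_D numeral_2_eq_2 Suc_le_mono)
  have a: "a i = b i * s i" if "i < ?N" for i using b[OF that] by (simp add: s_def)
  have sum: "(\<Sum>i\<in>{..<?N} - T. b i * s i ^ e * c (insert i T)) = c T * coeff (monom 1 e * weight_poly s T) (?N - 1)"
    if "T \<subseteq> {..<?N}" "2 * card T + e < ?N" for T e
    unfolding c_def by (rule vandermonde_weight_sum[OF inj b that])
  have fin: "finite T" if "T \<subseteq> {..<?N}" for T using that finite_subset by blast
  have co: "coeff (monom 1 e * weight_poly s T) (?N - 1) =
      (if 2 * card T + e = ?N - 1 then (-1) ^ card T else 0)"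
    if "T \<subseteq> {..<?N}" "2 * card T + e < ?N" for T e
  proof (cases "2 * card T + e = ?N - 1")
    case True
    then have "?N - 1 = 2 * card T + e" by simp
    then show ?thesis using weight_poly_degree[OF fin[OF that(1)], of s] by (simp add: coeff_monom_mult)
  next
    case False
    then have "degree (weight_poly s T) < ?N - 1 - e"
      using weight_poly_degree(1)[OF fin[OF that(1)], of s] that(2) by simp
    then show ?thesis using False by (simp add: coeff_monom_mult coeff_eq_0)
  qed
  have "dderiv ?N b H = sqfree_form ?N (Suc n') (\<lambda>T. \<Sum>i\<in>{..<?N} - T. b i * c (insert i T))"
    unfolding H_def n' by (rule dderiv_sqfree_form)
  also have "\<dots> = sqfree_form ?N (Suc n') (\<lambda>T. 0)"
  proof (rule sqfree_form_cong)
    fix T assume "T \<subseteq> {..<?N}" "card T = Suc n'"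
    then show "(\<Sum>i\<in>{..<?N} - T. b i * c (insert i T)) = 0"
      using sum[of T 0] co[of T 0] n' by simp
  qed
  finally have bH: "dderiv ?N b H = 0" by simp
  have "dderiv ?N a H = sqfree_form ?N (Suc n') (\<lambda>T. \<Sum>i\<in>{..<?N} - T. a i * c (insert i T))"
    unfolding H_def n' by (rule dderiv_sqfree_form)
  also have "\<dots> = sqfree_form ?N (Suc n') (\<lambda>T. c T * (-1) ^ Suc n')"
  proof (rule sqfree_form_cong)
    fix T assume "T \<subseteq> {..<?N}" "card T = Suc n'"
    then show "(\<Sum>i\<in>{..<?N} - T. a i * c (insert i T)) = c T * (-1) ^ Suc n'"
      using sum[of T 1] co[of T 1] n' by (simp add: a)
  qed
  finally have "dderiv ?N a (dderiv ?N a H) = sqfree_form ?N n'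
      (\<lambda>T. \<Sum>i\<in>{..<?N} - T. a i * (c (insert i T) * (-1) ^ Suc n'))"
    by (simp only: dderiv_sqfree_form)
  also have "\<dots> = sqfree_form ?N n' (\<lambda>T. 0)"
  proof (rule sqfree_form_cong)
    fix T assume T: "T \<subseteq> {..<?N}" "card T = n'"
    have "(\<Sum>i\<in>{..<?N} - T. a i * (c (insert i T) * (-1) ^ Suc n')) =
        (\<Sum>i\<in>{..<?N} - T. b i * s i ^ 1 * c (insert i T)) * (-1) ^ Suc n'"
      by (simp add: a sum_distrib_right mult.assoc sum_negf)
    also have "\<dots> = 0" using sum[of T 1] co[of T 1] n' T by simp
    finally show "(\<Sum>i\<in>{..<?N} - T. a i * (c (insert i T) * (-1) ^ Suc n')) = 0" .
  qed
  finally have aH: "dderiv ?N a (dderiv ?N a H) = 0" by simp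
  have Hk: "Poly_Mapping.keys m \<subseteq> {..<?N} \<and> (\<forall>i. lookup m i \<le> d - 1) \<and> mdegree m = n * (d - 1)"
    if "m \<in> Poly_Mapping.keys (H ^ (d - 1))" for m
    by (rule keys_power_bound[OF _ that]) (auto simp: H_def dest: keys_sqfree_form)
  have "lookup H (ind_monom {..<n}) \<noteq> 0"
    unfolding H_def using vandermonde_weight_nonzero[OF inj b]
    by (subst lookup_sqfree_form_ind_monom) (auto simp: c_def)
  then have "H \<noteq> 0" by auto
  show ?thesis
  proof
    show "H ^ (d - 1) \<noteq> 0" using \<open>H \<noteq> 0\<close> by simp
    show "Poly_Mapping.keys (H ^ (d - 1)) \<subseteq> small_monoms d ?N (int n * (int d - 1))"
    proof
      fix m assume "m \<in> Poly_Mapping.keys (H ^ (d - 1))"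
      from Hk[OF this] d show "m \<in> small_monoms d ?N (int n * (int d - 1))"
        by (auto simp: small_monoms_def of_nat_diff le_less_trans[of _ "d - 1" d])
    qed
    show "dderiv ?N b (H ^ (d - 1)) = 0"
      using derivation_nilpotent_power[where D = "dderiv ?N b" and a = 0 and f = H and k = "d - 1", OF dderiv_add dderiv_mult] bH by simp
    show "(dderiv ?N a ^^ d) (H ^ (d - 1)) = 0"
      using derivation_nilpotent_power[where D = "dderiv ?N a" and a = 1 and f = H and k = "d - 1", OF dderiv_add dderiv_mult] aH d by simp
  qed
qed

section \<open>Counting dimensions\<close>

text \<open>
Rank and nullity in the form of a count: the image of \<open>span A\<close> is a proper subspace of \<open>span Y\<close>, so it has
dimension less than \<open>card Y\<close>, and the kernel has dimension greater than \<open>card A - card Y\<close>, that is, greater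
than the dimension of \<open>span C\<close>.
\<close>

lemma (in vector_space_pair) kernel_not_in_span:
  assumes f: "Vector_Spaces.linear s1 s2 f" and A: "vs1.independent A" "finite A"
    and Y: "finite Y" "f ` A \<subseteq> vs2.span Y" and z: "z \<in> vs2.span Y" "z \<notin> f ` vs1.span A"
    and C: "finite C" "card C + card Y \<le> card A"
  shows "\<exists>v\<in>vs1.span A. f v = 0 \<and> v \<notin> vs1.span C"
proof (rule ccontr)
  assume *: "\<not> ?thesis"
  obtain M where M: "M \<subseteq> f ` A" "vs2.independent M" "f ` A \<subseteq> vs2.span M"
    by (rule vs2.maximal_independent_subset)
  obtain A' where A': "A' \<subseteq> A" "inj_on f A'" "M = f ` A'"
    using M(1) by (metis subset_image_inj)
  have finA': "finite A'" using A'(1) A(2) finite_subset by blast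
  \<comment> \<open>By assumption \<open>span C\<close> contains the kernel, so \<open>C\<close> and lifts of a basis of the image span everything.\<close>
  have "A \<subseteq> vs1.span (C \<union> A')"
  proof
    fix v assume v: "v \<in> A"
    then have "f v \<in> vs2.span (f ` A')" using M(3) A'(3) by blast
    then obtain w where w: "w \<in> vs1.span A'" "f v = f w"
      unfolding linear_span_image[OF f] by blast
    have "w \<in> vs1.span A" using w(1) A'(1) vs1.span_mono by blast
    then have "v - w \<in> vs1.span A" using v by (simp add: vs1.span_base vs1.span_diff)
    moreover have "f (v - w) = 0" using w(2) by (simp add: linear_diff[OF f])
    ultimately have "v - w \<in> vs1.span C" using * by blast
    then have "v - w \<in> vs1.span (C \<union> A')" using vs1.span_mono[of C "C \<union> A'"] by blast
    moreover have "w \<in> vs1.span (C \<union> A')" using w(1) vs1.span_mono[of A' "C \<union> A'"] by blast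
    ultimately show "v \<in> vs1.span (C \<union> A')" using vs1.span_add by fastforce
  qed
  then have "card A \<le> card (C \<union> A')"
    using vs1.independent_span_bound[of "C \<union> A'" A] A C(1) finA' by blast
  also have "\<dots> \<le> card C + card A'" by (rule card_Un_le)
  also have "card A' = card M" using A'(2,3) by (simp add: card_image)
  finally have 1: "card A \<le> card C + card M" .
  have "z \<notin> vs2.span M"
  proof
    assume "z \<in> vs2.span M"
    then have "z \<in> vs2.span (f ` A)" using M(1) vs2.span_mono by blast
    then show False using z(2) by (simp add: linear_span_image[OF f])
  qed
  then have ind: "vs2.independent (insert z M)" using M(2) by (rule vs2.independent_insertI)
  have "insert z M \<subseteq> vs2.span Y" using z(1) Y(2) M(1) by blast
  then have "card (insert z M) \<le> card Y"
    using vs2.independent_span_bound[OF Y(1) ind] by blast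
  moreover have "z \<notin> M" using \<open>z \<notin> vs2.span M\<close> vs2.span_base by blast
  moreover have "finite M" using A'(3) finA' by simp
  ultimately have "Suc (card M) \<le> card Y" by simp
  with 1 C(2) show False by simp
qed

abbreviation smult_mpoly :: "'a::field \<Rightarrow> 'a mpoly \<Rightarrow> 'a mpoly" where
  "smult_mpoly c p \<equiv> Poly_Mapping.single 0 c * p"

text \<open>
Pairs of polynomials form the domain of the linear map \<open>(p, q) \<mapsto> l p - L\<^sup>d q\<close>.
\<close>

definition smult_pair :: "'a::field \<Rightarrow> 'a mpoly \<times> 'a mpoly \<Rightarrow> 'a mpoly \<times> 'a mpoly" where
  "smult_pair c v = (smult_mpoly c (fst v), smult_mpoly c (snd v))"

interpretation mpoly_vs: vector_space "smult_mpoly :: 'a::field \<Rightarrow> 'a mpoly \<Rightarrow> 'a mpoly"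
  by unfold_locales (auto simp: single_add mult_single algebra_simps simp flip: mult.assoc)

interpretation pair_vs: vector_space "smult_pair :: 'a::field \<Rightarrow> 'a mpoly \<times> 'a mpoly \<Rightarrow> _"
  by unfold_locales (auto simp: smult_pair_def prod_eq_iff single_add mult_single algebra_simps simp flip: mult.assoc)

interpretation to_mpoly: vector_space_pair
  "smult_pair :: 'a::field \<Rightarrow> 'a mpoly \<times> 'a mpoly \<Rightarrow> _" smult_mpoly
  by unfold_locales

interpretation to_pair: vector_space_pair
  smult_mpoly "smult_pair :: 'a::field \<Rightarrow> 'a mpoly \<times> 'a mpoly \<Rightarrow> _"
  by unfold_locales

text \<open>
The normal form in \<open>B\<close> of the component of degree \<open>j\<close> of \<open>p\<close>.
\<close>

definition trunc :: "nat \<Rightarrow> nat \<Rightarrow> int \<Rightarrow> 'a::comm_monoid_add mpoly \<Rightarrow> 'a mpoly" where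
  "trunc d N j p = (\<Sum>m\<in>small_monoms d N j. Poly_Mapping.single m (lookup p m))"

lemma lookup_trunc: "lookup (trunc d N j p) m = (if m \<in> small_monoms d N j then lookup p m else 0)"
  by (simp add: trunc_def lookup_sum lookup_single when_def)

lemma trunc_add: "trunc d N j (p + q) = trunc d N j p + trunc d N j q"
  by (rule poly_mapping_eqI) (simp add: lookup_trunc lookup_add)

lemma trunc_smult: "trunc d N j (smult_mpoly c p) = smult_mpoly c (trunc d N j p)"
  by (rule poly_mapping_eqI) (simp add: lookup_trunc lookup_const_times)

lemma trunc_eq_0_iff: "trunc d N j p = 0 \<longleftrightarrow> vanish d N j p"
  by (auto simp: poly_mapping_eq_iff fun_eq_iff lookup_trunc vanish_def)

lemma trunc_in_span: "trunc d N j p \<in> mpoly_vs.span ((\<lambda>m. Poly_Mapping.single m 1) ` small_monoms d N j)"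
proof -
  have "trunc d N j p = (\<Sum>m\<in>small_monoms d N j. smult_mpoly (lookup p m) (Poly_Mapping.single m 1))"
    by (simp add: trunc_def mult_single)
  also have "\<dots> \<in> mpoly_vs.span ((\<lambda>m. Poly_Mapping.single m 1) ` small_monoms d N j)"
    by (intro mpoly_vs.span_sum mpoly_vs.span_scale mpoly_vs.span_base imageI)
  finally show ?thesis .
qed

definition supported :: "nat \<Rightarrow> nat \<Rightarrow> int \<Rightarrow> 'a::zero mpoly \<Rightarrow> bool" where
  "supported d N j p \<longleftrightarrow> Poly_Mapping.keys p \<subseteq> small_monoms d N j"

lemma supported_eq_trunc:
  assumes "supported d N j p" "vanish d N j (p - q)"
  shows "p = trunc d N j (q :: 'a::ab_group_add mpoly)"
  using assms by (intro poly_mapping_eqI)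
    (auto simp: supported_def lookup_trunc vanish_def lookup_minus in_keys_iff subset_iff)

lemma supported_vanish:
  assumes "supported d N j p" "i \<noteq> j"
  shows "vanish d N i p"
  using assms by (auto simp: supported_def vanish_def in_keys_iff subset_iff small_monoms_def)

lemma independent_unit_pairs:
  assumes "finite X" "finite Y"
  shows "pair_vs.independent ((\<lambda>m. (Poly_Mapping.single m (1::'a::field), 0)) ` X \<union>
            (\<lambda>m. (0, Poly_Mapping.single m 1)) ` Y)" (is "pair_vs.independent (?f ` X \<union> ?g ` Y)")
proof (rule pair_vs.independent_if_scalars_zero)
  fix u v assume sum: "(\<Sum>v\<in>?f ` X \<union> ?g ` Y. smult_pair (u v) v) = 0" and v: "v \<in> ?f ` X \<union> ?g ` Y"
  have fin: "finite (?f ` X \<union> ?g ` Y)" using assms by simp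
  have fst: "lookup (fst w) m = (if w = ?f m then 1 else 0)" if "w \<in> ?f ` X \<union> ?g ` Y" for w m
    using that by (auto simp: lookup_single when_def split: if_splits)
  have snd: "lookup (snd w) m = (if w = ?g m then 1 else 0)" if "w \<in> ?f ` X \<union> ?g ` Y" for w m
    using that by (auto simp: lookup_single when_def split: if_splits)
  show "u v = 0"
  proof (cases "v \<in> ?f ` X")
    case True
    then obtain m where m: "v = ?f m" by blast
    have "0 = lookup (fst (\<Sum>v\<in>?f ` X \<union> ?g ` Y. smult_pair (u v) v)) m" by (simp add: sum)
    also have "\<dots> = (\<Sum>w\<in>?f ` X \<union> ?g ` Y. if w = ?f m then u w else 0)"
      unfolding fst_sum lookup_sum
      by (intro sum.cong refl) (simp only: smult_pair_def fst_conv lookup_const_times fst, simp)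
    also have "\<dots> = u v" using fin v unfolding m by (subst sum.delta) auto
    finally show ?thesis by simp
  next
    case False
    then obtain m where m: "v = ?g m" using v by blast
    have "0 = lookup (snd (\<Sum>v\<in>?f ` X \<union> ?g ` Y. smult_pair (u v) v)) m" by (simp add: sum)
    also have "\<dots> = (\<Sum>w\<in>?f ` X \<union> ?g ` Y. if w = ?g m then u w else 0)"
      unfolding snd_sum lookup_sum
      by (intro sum.cong refl) (simp only: smult_pair_def snd_conv lookup_const_times snd, simp)
    also have "\<dots> = u v" using fin v unfolding m by (subst sum.delta) auto
    finally show ?thesis by simp
  qed
qed (use assms in simp)

lemma card_unit_pairs:
  fixes X Y :: "(nat \<Rightarrow>\<^sub>0 nat) set"
  assumes "finite X" "finite Y"
  shows "card ((\<lambda>m. (Poly_Mapping.single m (1::'a::field), 0 :: 'a mpoly)) ` X \<union>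
            (\<lambda>m. (0, Poly_Mapping.single m 1)) ` Y) = card X + card Y" (is "card (?f ` X \<union> ?g ` Y) = _")
proof -
  have single0: "Poly_Mapping.single m (1::'a) \<noteq> 0" for m :: "nat \<Rightarrow>\<^sub>0 nat"
    by (metis lookup_single_eq lookup_zero zero_neq_one)
  have inj: "Poly_Mapping.single m (1::'a) = Poly_Mapping.single k 1 \<longleftrightarrow> m = k" for m k :: "nat \<Rightarrow>\<^sub>0 nat"
    by (metis lookup_single_eq lookup_single_not_eq zero_neq_one)
  have "card (?f ` X) = card X" "card (?g ` Y) = card Y"
    by (auto intro!: card_image simp: inj_on_def inj)
  moreover have "?f ` X \<inter> ?g ` Y = {}" using single0 by auto
  ultimately show ?thesis using assms by (simp add: card_Un_disjoint)
qed

lemma apolar_trunc: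
  assumes "Poly_Mapping.keys G \<subseteq> small_monoms d N j"
  shows "apolar (trunc d N j u) G = apolar u G"
  unfolding apolar_def by (intro sum.cong refl) (use assms in \<open>auto simp: lookup_trunc\<close>)

text \<open>
A form all of whose exponents are below \<open>d\<close> is killed by all \<open>\<partial>\<^sub>i\<^sup>d\<close>, hence apolar to the ideal \<open>(x\<^sub>i\<^sup>d)\<close>.
\<close>

lemma apolar_eq_0:
  assumes "Poly_Mapping.keys G \<subseteq> small_monoms d N j" "vanish d N j u"
  shows "apolar u G = 0"
  unfolding apolar_def by (intro sum.neutral) (use assms in \<open>auto simp: vanish_def\<close>)

lemma apolar_single_left:
  assumes "m \<in> Poly_Mapping.keys G"
  shows "apolar (Poly_Mapping.single m 1) G = mfact m * lookup G m"
proof -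
  have "apolar (Poly_Mapping.single m 1) G =
      (\<Sum>k\<in>Poly_Mapping.keys G. if k = m then mfact m * lookup G m else 0)"
    unfolding apolar_def by (intro sum.cong refl) (auto simp: lookup_single when_def)
  then show ?thesis using assms by simp
qed

text \<open>
The conclusion describes an element \<open>p\<close> of \<open>A\<close> in degree \<open>t - 1\<close> that is nonzero (last clause) and killed by
\<open>l\<close> (third clause). In the proof, \<open>f\<close> is the map \<open>(p, q) \<mapsto> l p - L\<^sup>d q\<close> into degree \<open>t\<close> of \<open>B\<close>, whose values lie in the
hyperplane defined by \<open>G\<close>, and the pairs \<open>g r = (L\<^sup>d r, l r)\<close> are the trivial elements of its kernel.
\<close>

lemma multiplication_kernel:
  fixes a b :: "nat \<Rightarrow> 'a::field_char_0"
  assumes a: "\<And>i. i < 2 * n \<Longrightarrow> a i \<noteq> 0" and n: "3 \<le> n" and d: "2 \<le> d"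
    and t: "t = int n * (int d - 1)"
    and G: "G \<noteq> 0" "Poly_Mapping.keys G \<subseteq> small_monoms d (2 * n) t"
      "dderiv (2 * n) b G = 0" "(dderiv (2 * n) a ^^ d) G = 0"
  obtains p q where "supported d (2 * n) (t - 1) p" "supported d (2 * n) (t - int d) q"
    "\<And>j. vanish d (2 * n) j (lform (2 * n) b * p - lform (2 * n) a ^ d * q)"
    "\<And>r. \<not> vanish d (2 * n) (t - 1) (p - lform (2 * n) a ^ d * r)"
proof -
  let ?N = "2 * n"
  let ?X = "small_monoms d ?N" and ?v = "vanish d ?N"
  let ?L = "lform ?N a" and ?l = "lform ?N b"
  let ?mono = "\<lambda>m. Poly_Mapping.single m (1::'a)"
  define f where "f v = trunc d ?N t (?l * fst v - ?L ^ d * snd v)" for v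
  define g where "g r = (trunc d ?N (t - 1) (?L ^ d * r), trunc d ?N (t - int d) (?l * r))" for r
  let ?A = "(\<lambda>m. (?mono m, 0)) ` ?X (t - 1) \<union> (\<lambda>m. (0, ?mono m)) ` ?X (t - int d)"
  let ?C = "g ` ?mono ` ?X (t - 1 - int d)"
  have f: "Vector_Spaces.linear smult_pair smult_mpoly f"
    unfolding Vector_Spaces.linear_iff
  proof (intro conjI allI)
    show "f (v + w) = f v + f w" for v w
      unfolding f_def trunc_add[symmetric] by (rule arg_cong[where f = "trunc d ?N t"]) (simp add: algebra_simps)
    show "f (smult_pair c v) = smult_mpoly c (f v)" for c v
      unfolding f_def trunc_smult[symmetric] smult_pair_def
      by (rule arg_cong[where f = "trunc d ?N t"]) (simp add: algebra_simps)
  qed (fact pair_vs.vector_space_axioms mpoly_vs.vector_space_axioms)+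
  have g: "Vector_Spaces.linear smult_mpoly smult_pair g"
    unfolding Vector_Spaces.linear_iff
  proof (intro conjI allI)
    show "g (p + q) = g p + g q" for p q
      by (simp add: g_def distrib_left trunc_add)
    show "g (smult_mpoly c p) = smult_pair c (g p)" for c p
      by (simp add: g_def smult_pair_def mult.left_commute[of _ "Poly_Mapping.single 0 c"] trunc_smult)
  qed (fact pair_vs.vector_space_axioms mpoly_vs.vector_space_axioms)+
  obtain m0 where m0: "m0 \<in> Poly_Mapping.keys G" using G(1) by fastforce
  have apf: "apolar (f v) G = 0" for v
  proof -
    have "apolar (?l * fst v) G = 0" by (simp only: apolar_lform_times G(3) apolar_zero_right)
    moreover have "apolar (?L ^ d * (- snd v)) G = 0"
      by (simp only: apolar_lform_power_times G(4) apolar_zero_right)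
    ultimately have "apolar (?l * fst v + ?L ^ d * (- snd v)) G = 0" by (simp only: apolar_add_left add_0)
    then show ?thesis by (simp add: f_def apolar_trunc[OF G(2)])
  qed
  have "apolar (?mono m0) G = mfact m0 * lookup G m0" by (rule apolar_single_left[OF m0])
  then have "apolar (?mono m0) G \<noteq> 0" using m0 by (simp add: mfact_nonzero in_keys_iff)
  then have z: "?mono m0 \<notin> f ` pair_vs.span ?A" using apf by auto
  have "\<exists>v\<in>pair_vs.span ?A. f v = 0 \<and> v \<notin> pair_vs.span ?C"
  proof (rule to_mpoly.kernel_not_in_span[OF f _ _ _ _ _ z])
    show "pair_vs.independent ?A" by (rule independent_unit_pairs) simp_all
    show "f ` ?A \<subseteq> mpoly_vs.span (?mono ` ?X t)" by (auto simp: f_def trunc_in_span)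
    show "?mono m0 \<in> mpoly_vs.span (?mono ` ?X t)"
      using m0 G(2) by (auto intro: mpoly_vs.span_base)
    have "card ?C \<le> card (?X (t - 1 - int d))"
      by (rule order_trans[OF card_image_le card_image_le]) simp_all
    moreover have "card (?mono ` ?X t) \<le> card (?X t)" by (rule card_image_le) simp
    moreover have "card ?A = card (?X (t - 1)) + card (?X (t - int d))"
      by (rule card_unit_pairs) simp_all
    ultimately show "card ?C + card (?mono ` ?X t) \<le> card ?A"
      using card_small_monoms_ineq[OF d n] unfolding t by linarith
  qed simp_all
  then obtain p q where pq: "(p, q) \<in> pair_vs.span ?A" "f (p, q) = 0" "(p, q) \<notin> pair_vs.span ?C"
    by auto
  have "pair_vs.span ?A \<subseteq> {v. supported d ?N (t - 1) (fst v) \<and> supported d ?N (t - int d) (snd v)}"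
  proof (rule pair_vs.span_minimal)
    show "pair_vs.subspace {v. supported d ?N (t - 1) (fst v) \<and> supported d ?N (t - int d) (snd v)}"
      unfolding pair_vs.subspace_def
      by (auto simp: supported_def smult_pair_def subset_iff in_keys_iff lookup_add lookup_const_times)
         (metis add_0)+
  qed (auto simp: supported_def)
  with pq(1) have supp: "supported d ?N (t - 1) p" "supported d ?N (t - int d) q" by auto
  have van: "?v j (?l * p - ?L ^ d * q)" for j
  proof (cases "j = t")
    case True
    then show ?thesis using pq(2) by (simp add: f_def trunc_eq_0_iff)
  next
    case False
    have "?v j (?l * p)" using vanish_lform_times[of d ?N "j - 1" p b] supported_vanish[OF supp(1)] False by simp
    moreover have "?v j (?L ^ d * q)"
      using vanish_lform_power_times[of d ?N "j - int d" q d a] supported_vanish[OF supp(2)] False by simp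
    ultimately show ?thesis by (rule vanish_diff)
  qed
  \<comment> \<open>If \<open>p = L\<^sup>d r\<close> in \<open>B\<close>, then \<open>L\<^sup>d (q - l r) = 0\<close>; as \<open>L\<^sup>d\<close> is injective, the solution is a trivial one.\<close>
  have "\<not> ?v (t - 1) (p - ?L ^ d * r)" for r
  proof
    assume r: "?v (t - 1) (p - ?L ^ d * r)"
    \<comment> \<open>Only the component of \<open>r\<close> in degree \<open>t - 1 - d\<close> affects degree \<open>t - 1\<close>.\<close>
    define r' where "r' = trunc d ?N (t - 1 - int d) r"
    have "?v (t - 1 - int d) (r - r')" by (simp add: r'_def vanish_def lookup_minus lookup_trunc)
    then have "?v (t - 1) (?L ^ d * (r - r'))"
      using vanish_lform_power_times[of d ?N "t - 1 - int d" "r - r'" d a] by simp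
    with r have r': "?v (t - 1) (p - ?L ^ d * r')"
      using vanish_add[of d ?N "t - 1" "p - ?L ^ d * r" "?L ^ d * (r - r')"] by (simp add: algebra_simps)
    then have p: "p = trunc d ?N (t - 1) (?L ^ d * r')" by (rule supported_eq_trunc[OF supp(1)])
    have "?v t (?l * (p - ?L ^ d * r'))" using vanish_lform_times[OF r', of b] by simp
    from vanish_diff[OF this van[of t]] have "?v t (?L ^ d * (q - ?l * r'))" by (simp add: algebra_simps)
    then have "?v (t - int d) (q - ?l * r')"
      using lform_power_injective[where N = ?N and a = a and j = "t - int d" and e = d, OF a] t by simp
    then have "q = trunc d ?N (t - int d) (?l * r')" by (rule supported_eq_trunc[OF supp(2)])
    with p have "(p, q) = g r'" by (simp add: g_def)
    moreover have "g r' \<in> g ` mpoly_vs.span (?mono ` ?X (t - 1 - int d))"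
      unfolding r'_def using trunc_in_span by blast
    ultimately have "(p, q) \<in> pair_vs.span ?C"
      by (simp only: to_pair.linear_span_image[OF g])
    with pq(3) show False by blast
  qed
  with supp van show ?thesis by (rule that)
qed

section \<open>The ideal generated by the powers\<close>

lemma mpoly_ring_carrier: "p \<in> carrier (mpoly_ring N) \<longleftrightarrow> (\<forall>m\<in>Poly_Mapping.keys p. Poly_Mapping.keys m \<subseteq> {..<N})"
  by (simp add: mpoly_ring_def)

lemma mpoly_ring_simps [simp]:
  "p \<otimes>\<^bsub>mpoly_ring N\<^esub> q = p * q" "\<one>\<^bsub>mpoly_ring N\<^esub> = 1"
  "p \<oplus>\<^bsub>mpoly_ring N\<^esub> q = p + q" "\<zero>\<^bsub>mpoly_ring N\<^esub> = 0"
  by (simp_all add: mpoly_ring_def)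

lemma mpoly_ring_closed:
  "p \<in> carrier (mpoly_ring N) \<Longrightarrow> q \<in> carrier (mpoly_ring N) \<Longrightarrow> p + q \<in> carrier (mpoly_ring N)"
  "p \<in> carrier (mpoly_ring N) \<Longrightarrow> q \<in> carrier (mpoly_ring N) \<Longrightarrow> p * q \<in> carrier (mpoly_ring N)"
  "p \<in> carrier (mpoly_ring N) \<Longrightarrow> - p \<in> carrier (mpoly_ring N)"
  "0 \<in> carrier (mpoly_ring N)" "1 \<in> carrier (mpoly_ring N)"
proof -
  assume "p \<in> carrier (mpoly_ring N)" "q \<in> carrier (mpoly_ring N)"
  then show "p + q \<in> carrier (mpoly_ring N)"
    using Poly_Mapping.keys_add[of p q] by (fastforce simp: mpoly_ring_carrier)
next
  assume *: "p \<in> carrier (mpoly_ring N)" "q \<in> carrier (mpoly_ring N)"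
  show "p * q \<in> carrier (mpoly_ring N)" unfolding mpoly_ring_carrier
  proof
    fix m assume "m \<in> Poly_Mapping.keys (p * q)"
    then obtain x y where "m = x + y" "x \<in> Poly_Mapping.keys p" "y \<in> Poly_Mapping.keys q"
      using keys_mult[of p q] by auto
    then show "Poly_Mapping.keys m \<subseteq> {..<N}"
      using * Poly_Mapping.keys_add[of x y] unfolding mpoly_ring_carrier by blast
  qed
qed (auto simp: mpoly_ring_carrier in_keys_iff lookup_one when_def)

lemma cring_mpoly_ring: "cring (mpoly_ring N :: 'a::field mpoly ring)"
proof (rule cringI)
  show "abelian_group (mpoly_ring N :: 'a mpoly ring)"
    by (rule abelian_groupI) (auto simp: mpoly_ring_closed algebra_simps intro: bexI[of _ "- _"])
  show "Group.comm_monoid (mpoly_ring N :: 'a mpoly ring)"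
    by (rule comm_monoidI) (auto simp: mpoly_ring_closed algebra_simps)
qed (simp add: algebra_simps)

lemma mpoly_ring_minus:
  fixes p q :: "'a::field mpoly"
  assumes "p \<in> carrier (mpoly_ring N)" "q \<in> carrier (mpoly_ring N)"
  shows "p \<ominus>\<^bsub>mpoly_ring N\<^esub> q = p - q"
proof -
  interpret cring "mpoly_ring N :: 'a mpoly ring" by (rule cring_mpoly_ring)
  have "\<ominus>\<^bsub>mpoly_ring N\<^esub> q = - q"
    by (rule minus_equality) (use assms in \<open>auto simp: mpoly_ring_closed\<close>)
  then show ?thesis by (simp add: a_minus_def)
qed

lemma mpoly_ring_power_closed: "p \<in> carrier (mpoly_ring N) \<Longrightarrow> p ^ k \<in> carrier (mpoly_ring N)"
  by (induction k) (auto intro: mpoly_ring_closed)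

lemma mvar_power: "mvar i ^ k = Poly_Mapping.single (Poly_Mapping.single i k) 1"
  by (induction k) (simp_all add: mvar_def mult_single single_add[symmetric])

lemma lform_carrier: "lform N a \<in> carrier (mpoly_ring N)"
  unfolding mpoly_ring_carrier
proof
  fix m assume "m \<in> Poly_Mapping.keys (lform N a)"
  then have "m \<in> (\<Union>i<N. Poly_Mapping.keys (Poly_Mapping.single (evar i) (a i)))"
    unfolding lform_def by (rule subsetD[OF Poly_Mapping.keys_sum])
  then show "Poly_Mapping.keys m \<subseteq> {..<N}" by (auto split: if_splits)
qed

lemma mdegree_1_imp_evar:
  assumes "mdegree m = 1"
  obtains i where "i \<in> Poly_Mapping.keys m" "m = evar i"
proof -
  have "m \<noteq> 0" using assms by (auto simp: mdegree_def)
  then obtain i where i: "i \<in> Poly_Mapping.keys m" by fastforce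
  then have eq: "m - evar i + evar i = m" by (intro minus_evar_plus_evar) (simp add: in_keys_iff)
  then have "mdegree (m - evar i) + 1 = mdegree m" by (metis mdegree_add mdegree_evar)
  then have "m - evar i = 0" using assms by (simp add: mdegree_eq_0_iff)
  with eq have "m = evar i" by simp
  with i that show ?thesis by blast
qed

lemma evar_eq_iff: "evar i = evar k \<longleftrightarrow> i = k"
  by (metis lookup_evar zero_neq_one)

lemma lookup_lform_evar: "i < N \<Longrightarrow> lookup (lform N a) (evar i) = a i"
  by (simp add: lform_def lookup_sum lookup_single when_def evar_eq_iff)

lemma coeff_vec_alt: "coeff_vec N L = (\<lambda>i\<in>{..<N}. lookup L (evar i))"
  by (simp add: coeff_vec_def evar_def)

lemma lform_coeff_vec:
  assumes "L \<in> homog N 1"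
  shows "L = lform N (coeff_vec N L)"
proof (rule poly_mapping_eqI)
  fix m
  show "lookup L m = lookup (lform N (coeff_vec N L)) m"
  proof (cases "\<exists>i<N. m = evar i")
    case True
    then show ?thesis by (auto simp: lookup_lform_evar coeff_vec_alt)
  next
    case False
    have "m \<notin> Poly_Mapping.keys L"
    proof
      assume "m \<in> Poly_Mapping.keys L"
      then have "Poly_Mapping.keys m \<subseteq> {..<N}" "mdegree m = 1"
        using assms by (auto simp: homog_def mpoly_ring_carrier)
      with False show False by (metis mdegree_1_imp_evar lessThan_iff subsetD)
    qed
    moreover have "lookup (lform N (coeff_vec N L)) m = 0"
      unfolding lform_def lookup_sum using False by (auto simp: lookup_single when_def intro!: sum.neutral)
    ultimately show ?thesis by (simp add: in_keys_iff)
  qed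
qed

lemma lform_homog: "lform N b \<in> homog N 1"
  unfolding homog_def
proof (intro CollectI conjI lform_carrier ballI)
  fix m assume "m \<in> Poly_Mapping.keys (lform N b)"
  then have "m \<in> (\<Union>i<N. Poly_Mapping.keys (Poly_Mapping.single (evar i) (b i)))"
    unfolding lform_def by (rule subsetD[OF Poly_Mapping.keys_sum])
  then show "int (mdegree m) = 1" by (auto split: if_splits)
qed

lemma coeff_vec_lform: "b \<in> {..<N} \<rightarrow>\<^sub>E UNIV \<Longrightarrow> coeff_vec N (lform N b) = b"
  by (auto simp: coeff_vec_alt fun_eq_iff lookup_lform_evar PiE_def extensional_def)

lemma homog_carrier: "p \<in> homog N t \<Longrightarrow> p \<in> carrier (mpoly_ring N)"
  by (simp add: homog_def)

lemma homog_mult: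
  assumes "p \<in> homog N s" "q \<in> homog N t"
  shows "p * q \<in> homog N (s + t)"
  unfolding homog_def
proof (intro CollectI conjI ballI mpoly_ring_closed homog_carrier[OF assms(1)] homog_carrier[OF assms(2)])
  fix m assume "m \<in> Poly_Mapping.keys (p * q)"
  then obtain x y where "m = x + y" "x \<in> Poly_Mapping.keys p" "y \<in> Poly_Mapping.keys q"
    using keys_mult[of p q] by auto
  then show "int (mdegree m) = s + t" using assms by (simp add: homog_def mdegree_add)
qed

abbreviation power_ideal :: "nat \<Rightarrow> nat \<Rightarrow> 'a::field mpoly \<Rightarrow> 'a mpoly set" where
  "power_ideal N d L \<equiv> Idl\<^bsub>mpoly_ring N\<^esub> ({mvar i ^ d | i. i < N} \<union> {L ^ d})"

lemma power_ideal_gens: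
  assumes "L \<in> carrier (mpoly_ring N)"
  shows "{mvar i ^ d | i. i < N} \<union> {L ^ d} \<subseteq> carrier (mpoly_ring N)"
  using mpoly_ring_power_closed[OF assms] by (auto simp: mvar_power mpoly_ring_carrier split: if_splits)

lemma ideal_power_ideal:
  assumes "L \<in> carrier (mpoly_ring N)"
  shows "ideal (power_ideal N d L) (mpoly_ring N)"
  using ring.genideal_ideal[OF cring.axioms(1)[OF cring_mpoly_ring] power_ideal_gens[OF assms]] .

text \<open>
The polynomials of the form \<open>L\<^sup>d r\<close> plus a combination of monomials with an exponent at least \<open>d\<close> form an
ideal that contains the generators.
\<close>

lemma power_ideal_vanish:
  fixes L :: "'a::field mpoly"
  assumes p: "p \<in> power_ideal N d L" and L: "L \<in> carrier (mpoly_ring N)"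
  obtains r where "\<And>j. vanish d N j (p - L ^ d * r)"
proof -
  define big where "big u \<longleftrightarrow> (\<forall>m\<in>Poly_Mapping.keys u. \<exists>i. d \<le> lookup m i)" for u :: "'a mpoly"
  define K where "K = {p \<in> carrier (mpoly_ring N). \<exists>r. big (p - L ^ d * r)}"
  have big_add: "big (u + v)" if "big u" "big v" for u v
    using that Poly_Mapping.keys_add[of u v] by (auto simp: big_def)
  have big_neg: "big (- u)" if "big u" for u
    using that by (simp add: big_def in_keys_iff)
  have big_mult: "big (v * u)" if u: "big u" for u v
    unfolding big_def
  proof
    fix m assume "m \<in> Poly_Mapping.keys (v * u)"
    then obtain x y where xy: "m = x + y" "y \<in> Poly_Mapping.keys u" using keys_mult[of v u] by auto
    then obtain i where "d \<le> lookup y i" using u by (auto simp: big_def)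
    then show "\<exists>i. d \<le> lookup m i" using xy by (auto simp: lookup_add intro!: exI[of _ i])
  qed
  interpret cring "mpoly_ring N :: 'a mpoly ring" by (rule cring_mpoly_ring)
  have uminus: "\<ominus>\<^bsub>mpoly_ring N\<^esub> q = - q" if "q \<in> carrier (mpoly_ring N)" for q :: "'a mpoly"
    by (rule minus_equality) (use that in \<open>auto simp: mpoly_ring_closed\<close>)
  have mult_closed: "x * q \<in> K" if q: "q \<in> K" and x: "x \<in> carrier (mpoly_ring N)" for x q
  proof -
    obtain r where "big (q - L ^ d * r)" using q by (auto simp: K_def)
    from big_mult[OF this, of x] have "big (x * q - L ^ d * (x * r))" by (simp add: algebra_simps)
    then show ?thesis using q x by (auto simp: K_def mpoly_ring_closed)
  qed
  have "ideal K (mpoly_ring N)"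
  proof (rule idealI)
    show "ring (mpoly_ring N :: 'a mpoly ring)" by (rule ring_axioms)
    show "subgroup K (add_monoid (mpoly_ring N))"
    proof (rule add.subgroupI)
      show "K \<subseteq> carrier (mpoly_ring N)" by (auto simp: K_def)
      have "0 \<in> K" by (auto simp: K_def mpoly_ring_closed big_def intro!: exI[of _ 0])
      then show "K \<noteq> {}" by auto
    next
      fix q assume q: "q \<in> K"
      then obtain r where "big (q - L ^ d * r)" by (auto simp: K_def)
      from big_neg[OF this] have "big (- q - L ^ d * (- r))" by simp
      then have "\<exists>r. big (- q - L ^ d * r)" by (rule exI)
      then show "\<ominus>\<^bsub>mpoly_ring N\<^esub> q \<in> K"
        using q uminus[of q] by (auto simp: K_def mpoly_ring_closed)
    next
      fix q q' assume q: "q \<in> K" "q' \<in> K"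
      then obtain r r' where "big (q - L ^ d * r)" "big (q' - L ^ d * r')" by (auto simp: K_def)
      from big_add[OF this] have "big (q + q' - L ^ d * (r + r'))" by (simp add: algebra_simps)
      then show "q \<oplus>\<^bsub>mpoly_ring N\<^esub> q' \<in> K" using q by (auto simp: K_def mpoly_ring_closed)
    qed
  next
    fix q x :: "'a mpoly" assume qx: "q \<in> K" "x \<in> carrier (mpoly_ring N)"
    show "x \<otimes>\<^bsub>mpoly_ring N\<^esub> q \<in> K" using mult_closed[OF qx] by simp
    show "q \<otimes>\<^bsub>mpoly_ring N\<^esub> x \<in> K" using mult_closed[OF qx] by (simp add: mult.commute)
  qed
  moreover have "{mvar i ^ d | i. i < N} \<union> {L ^ d} \<subseteq> K"
  proof -
    have "big (mvar i ^ d - L ^ d * 0)" for i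
      by (auto simp: big_def mvar_power intro!: exI[of _ i])
    moreover have "big (L ^ d - L ^ d * 1)" by (simp add: big_def)
    ultimately show ?thesis using power_ideal_gens[OF L, of d] unfolding K_def by blast
  qed
  ultimately have "p \<in> K" using p genideal_minimal by blast
  then obtain r where r: "big (p - L ^ d * r)" by (auto simp: K_def)
  have "vanish d N j (p - L ^ d * r)" for j
    unfolding vanish_def
  proof (rule ballI, rule ccontr)
    fix m assume m: "m \<in> small_monoms d N j" and "lookup (p - L ^ d * r) m \<noteq> 0"
    then have "m \<in> Poly_Mapping.keys (p - L ^ d * r)" unfolding in_keys_iff by blast
    with r obtain i where "d \<le> lookup m i" unfolding big_def by blast
    moreover have "lookup m i < d" using m by (simp add: small_monoms_def)
    ultimately show False by simp
  qed
  then show ?thesis by (rule that)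
qed

lemma vanish_imp_power_ideal:
  fixes L :: "'a::field mpoly"
  assumes L: "L \<in> carrier (mpoly_ring N)" and p: "p \<in> carrier (mpoly_ring N)"
    and q: "q \<in> carrier (mpoly_ring N)" and d: "1 \<le> d"
    and van: "\<And>j. vanish d N j (p - L ^ d * q)"
  shows "p \<in> power_ideal N d L"
proof -
  define I where "I = power_ideal N d L"
  interpret I: ideal I "mpoly_ring N" unfolding I_def by (rule ideal_power_ideal[OF L])
  have add: "u + v \<in> I" if "u \<in> I" "v \<in> I" for u v using additive_subgroup.a_closed[OF I.additive_subgroup_axioms that] by simp
  have mult: "u * v \<in> I" if "u \<in> I" "v \<in> carrier (mpoly_ring N)" for u v
    using I.I_r_closed[OF that] by simp
  have zero: "0 \<in> I" using additive_subgroup.zero_closed[OF I.additive_subgroup_axioms] by simp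
  have gens: "{mvar i ^ d | i. i < N} \<union> {L ^ d} \<subseteq> I" unfolding I_def by (rule I.genideal_self[OF power_ideal_gens[OF L]])
  define u where "u = p - L ^ d * q"
  have u: "u \<in> carrier (mpoly_ring N)"
    using mpoly_ring_closed(1)[OF p mpoly_ring_closed(3)[OF mpoly_ring_closed(2)[OF mpoly_ring_power_closed[OF L] q]]]
    by (simp add: u_def)
  have single: "Poly_Mapping.single m c \<in> I" if m: "m \<in> Poly_Mapping.keys u" for m c
  proof -
    have keys: "Poly_Mapping.keys m \<subseteq> {..<N}" using u m by (simp add: mpoly_ring_carrier)
    have "m \<notin> small_monoms d N (int (mdegree m))"
      using van[of "int (mdegree m)"] m by (auto simp: u_def vanish_def in_keys_iff)
    then obtain i where i: "d \<le> lookup m i" using keys by (auto simp: small_monoms_def not_less)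
    then have "i \<in> Poly_Mapping.keys m" using d by (simp add: in_keys_iff)
    then have "mvar i ^ d \<in> I" using keys gens by blast
    moreover have "Poly_Mapping.single (m - Poly_Mapping.single i d) c \<in> carrier (mpoly_ring N)"
    proof -
      have "Poly_Mapping.keys (m - Poly_Mapping.single i d) \<subseteq> Poly_Mapping.keys m"
        by (auto simp: in_keys_iff lookup_minus)
      with keys show ?thesis by (auto simp: mpoly_ring_carrier split: if_splits)
    qed
    ultimately have "mvar i ^ d * Poly_Mapping.single (m - Poly_Mapping.single i d) c \<in> I" by (rule mult)
    moreover have "Poly_Mapping.single i d + (m - Poly_Mapping.single i d) = m"
      using i by (intro poly_mapping_eqI) (auto simp: lookup_add lookup_minus lookup_single when_def)
    ultimately show ?thesis by (simp add: mvar_power mult_single)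
  qed
  have "(\<Sum>m\<in>A. Poly_Mapping.single m (lookup u m)) \<in> I" if "A \<subseteq> Poly_Mapping.keys u" for A
    using finite_subset[OF that finite_keys] that
    by (induction A rule: finite_induct) (auto intro: zero add single)
  moreover have "u = (\<Sum>m\<in>Poly_Mapping.keys u. Poly_Mapping.single m (lookup u m))"
    by (rule poly_mapping_eqI) (auto simp: lookup_sum lookup_single when_def in_keys_iff)
  ultimately have "u \<in> I" by (metis order_refl)
  moreover have "L ^ d * q \<in> I" using gens q by (intro mult) auto
  ultimately have "u + L ^ d * q \<in> I" by (rule add)
  then show ?thesis by (simp add: u_def I_def)
qed

section \<open>Failure of the Weak Lefschetz Property\<close>

text \<open>
The two halves of the argument, transferred to cosets: \<open>multiplication_kernel\<close> yields a nonzero kernel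
element, and the pairing with \<open>G\<close> is a nonzero functional on \<open>[A]\<^sub>t\<close> that vanishes on the image.
\<close>

lemma multiplication_not_max_rank:
  fixes a b :: "nat \<Rightarrow> 'a::field_char_0" and n d :: nat
  defines "N \<equiv> 2 * n"
  defines "I \<equiv> power_ideal N d (lform N a)"
  defines "mult_l \<equiv> \<lambda>A. (I +>\<^bsub>mpoly_ring N\<^esub> lform N b) \<otimes>\<^bsub>mpoly_ring N Quot I\<^esub> A"
  assumes a: "\<And>i. i < N \<Longrightarrow> a i \<noteq> 0" and b: "\<And>i. i < N \<Longrightarrow> b i \<noteq> 0"
    and ratio: "inj_on (\<lambda>i. a i / b i) {..<N}" and n: "3 \<le> n" and d: "2 \<le> d"
  defines "t \<equiv> int n * (int d - 1)"
  shows "\<not> inj_on mult_l (quot_homog N I (t - 1))"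
    and "mult_l ` quot_homog N I (t - 1) \<noteq> quot_homog N I t"
proof -
  let ?R = "mpoly_ring N :: 'a mpoly ring" and ?L = "lform N a" and ?l = "lform N b"
  have L: "?L \<in> carrier ?R" and l: "?l \<in> carrier ?R" by (rule lform_carrier)+
  interpret R: cring ?R by (rule cring_mpoly_ring)
  interpret I: ideal I ?R unfolding I_def by (rule ideal_power_ideal[OF L])
  have coset_eq: "I +>\<^bsub>?R\<^esub> p = I +>\<^bsub>?R\<^esub> q \<longleftrightarrow> p - q \<in> I" if "p \<in> carrier ?R" "q \<in> carrier ?R" for p q
    using R.quotient_eq_iff_same_a_r_cos[OF I.ideal_axioms that] mpoly_ring_minus[OF that] by simp
  have mult: "mult_l (I +>\<^bsub>?R\<^esub> p) = I +>\<^bsub>?R\<^esub> (?l * p)" if "p \<in> carrier ?R" for p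
    using I.rcoset_mult_add[OF l that] by (simp add: mult_l_def FactRing_def)
  obtain G where G: "G \<noteq> 0" "Poly_Mapping.keys G \<subseteq> small_monoms d N t"
      "dderiv N b G = 0" "(dderiv N a ^^ d) G = 0"
    using dual_generator_exists[of n d b a] n d b ratio unfolding N_def t_def by auto
  obtain p q where p: "supported d N (t - 1) p" and q: "supported d N (t - int d) q"
    and van: "\<And>j. vanish d N j (?l * p - ?L ^ d * q)"
    and nv: "\<And>r. \<not> vanish d N (t - 1) (p - ?L ^ d * r)"
    using multiplication_kernel[where n = n and a = a and b = b and d = d and t = t and G = G,
        OF a[unfolded N_def] n d _ G[unfolded N_def]]
    unfolding N_def t_def by blast
  have supp: "u \<in> homog N j" if "supported d N j u" for u :: "'a mpoly" and j
    using that by (auto simp: supported_def homog_def small_monoms_def mpoly_ring_carrier)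
  have carr: "p \<in> carrier ?R" "q \<in> carrier ?R" "?l * p \<in> carrier ?R"
    using supp[OF p] supp[OF q] l by (auto intro: homog_carrier mpoly_ring_closed)
  have lp: "?l * p \<in> I" unfolding I_def
    by (rule vanish_imp_power_ideal[OF L carr(3) carr(2) _ van]) (use d in simp)
  have pI: "p \<notin> I"
  proof
    assume "p \<in> I"
    then obtain r where "\<And>j. vanish d N j (p - ?L ^ d * r)"
      unfolding I_def using power_ideal_vanish[OF _ L] by blast
    with nv show False by blast
  qed
  have zero: "0 \<in> carrier ?R" "0 \<in> homog N (t - 1)" by (simp_all add: mpoly_ring_closed homog_def)
  show "\<not> inj_on mult_l (quot_homog N I (t - 1))"
  proof
    assume inj: "inj_on mult_l (quot_homog N I (t - 1))"
    have "mult_l (I +>\<^bsub>?R\<^esub> p) = mult_l (I +>\<^bsub>?R\<^esub> 0)"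
      using lp carr zero coset_eq[of "?l * p" 0] by (simp add: mult)
    then have "I +>\<^bsub>?R\<^esub> p = I +>\<^bsub>?R\<^esub> 0"
      by (rule inj_onD[OF inj]) (use supp[OF p] zero in \<open>auto simp: quot_homog_def\<close>)
    then show False using pI carr(1) zero(1) coset_eq[of p 0] by simp
  qed
  show "mult_l ` quot_homog N I (t - 1) \<noteq> quot_homog N I t"
  proof
    assume onto: "mult_l ` quot_homog N I (t - 1) = quot_homog N I t"
    obtain m where m: "m \<in> Poly_Mapping.keys G" using G(1) by fastforce
    define z where "z = Poly_Mapping.single m (1::'a)"
    have "supported d N t z" using m G(2) by (auto simp: z_def supported_def)
    then have z: "z \<in> homog N t" by (rule supp)
    then have "I +>\<^bsub>?R\<^esub> z \<in> mult_l ` quot_homog N I (t - 1)" unfolding onto by (simp add: quot_homog_def)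
    then obtain u where u: "u \<in> homog N (t - 1)" "I +>\<^bsub>?R\<^esub> z = mult_l (I +>\<^bsub>?R\<^esub> u)"
      by (auto simp: quot_homog_def)
    have "z - ?l * u \<in> I"
      using u z l coset_eq[of z "?l * u"] by (simp add: mult homog_carrier mpoly_ring_closed)
    then obtain r where "\<And>j. vanish d N j (z - ?l * u - ?L ^ d * r)"
      unfolding I_def using power_ideal_vanish[OF _ L] by blast
    then have 0: "apolar (z - ?l * u - ?L ^ d * r) G = 0" by (rule apolar_eq_0[OF G(2)])
    have "z = (z - ?l * u - ?L ^ d * r) + ?l * u + ?L ^ d * r" by simp
    then have "apolar z G = apolar (z - ?l * u - ?L ^ d * r) G + apolar (?l * u) G + apolar (?L ^ d * r) G"
      by (metis apolar_add_left)
    also have "\<dots> = 0"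
      unfolding 0 apolar_lform_times apolar_lform_power_times G(3,4) by simp
    finally have "apolar z G = 0" .
    moreover have "apolar z G = mfact m * lookup G m"
      unfolding z_def by (rule apolar_single_left[OF m])
    ultimately show False using m by (simp add: mfact_nonzero in_keys_iff)
  qed
qed

lemma meval_on_line:
  fixes f :: "'a::field mpoly"
  obtains P where "\<And>s. poly P s = meval (\<lambda>i. c i + s * e i) f"
proof -
  have "poly (\<Sum>m\<in>Poly_Mapping.keys f. [:lookup f m:] * (\<Prod>i\<in>Poly_Mapping.keys m. [:c i, e i:] ^ lookup m i)) s =
      meval (\<lambda>i. c i + s * e i) f" for s
    by (simp add: meval_def poly_sum poly_prod)
  then show ?thesis by (rule that)
qed

lemma meval_cong:
  assumes "f \<in> carrier (mpoly_ring N)" "\<And>i. i < N \<Longrightarrow> c i = c' i"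
  shows "meval c f = meval c' f"
  unfolding meval_def
  by (intro sum.cong prod.cong arg_cong2[where f = "(*)"] refl)
     (use assms in \<open>auto simp: mpoly_ring_carrier subset_iff\<close>)

text \<open>
Two nonempty open sets meet: join a point \<open>c\<close> of \<open>U\<close> to a direction \<open>e\<close> in which the required
inequalities hold asymptotically. Each condition on the point \<open>c + s e\<close> excludes only the roots of a
nonzero polynomial in \<open>s\<close>, and the field is infinite. The choice \<open>e\<^sub>i = a\<^sub>i/(i + 1)\<close> has the distinct
ratios \<open>a\<^sub>i/e\<^sub>i = i + 1\<close>.
\<close>

lemma general_point_exists:
  fixes a :: "nat \<Rightarrow> 'a::field_char_0"
  assumes a: "\<And>i. i < N \<Longrightarrow> a i \<noteq> 0" and U: "zariski_open N U" "U \<noteq> {}"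
  obtains b where "b \<in> U" "\<And>i. i < N \<Longrightarrow> b i \<noteq> 0" "inj_on (\<lambda>i. a i / b i) {..<N}"
proof -
  obtain S where S: "S \<subseteq> carrier (mpoly_ring N)"
      "({..<N} \<rightarrow>\<^sub>E UNIV) - U = {c \<in> {..<N} \<rightarrow>\<^sub>E UNIV. \<forall>f\<in>S. meval c f = 0}"
    using U(1) unfolding zariski_open_def zariski_closed_def by blast
  obtain c where c: "c \<in> U" using U(2) by blast
  have UP: "U \<subseteq> {..<N} \<rightarrow>\<^sub>E UNIV" using U(1) by (simp add: zariski_open_def)
  have "c \<notin> {c \<in> {..<N} \<rightarrow>\<^sub>E UNIV. \<forall>f\<in>S. meval c f = 0}" using c S(2) by blast
  then obtain f where f: "f \<in> S" "meval c f \<noteq> 0" using c UP by blast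
  define e where "e i = a i / of_nat (Suc i)" for i
  obtain P where P: "\<And>s. poly P s = meval (\<lambda>i. c i + s * e i) f" using meval_on_line[of c e f] by blast
  define T where "T = P * (\<Prod>i<N. [:c i, e i:]) *
      (\<Prod>i<N. \<Prod>j\<in>{..<N} - {i}. [:a i * c j - a j * c i, a i * e j - a j * e i:])"
  have "poly P 0 \<noteq> 0" using f(2) by (simp add: P)
  moreover have "e i \<noteq> 0" if "i < N" for i using a[OF that] by (simp add: e_def del: of_nat_Suc)
  moreover have "a i * e j - a j * e i \<noteq> 0" if "i < N" "j < N" "i \<noteq> j" for i j
  proof -
    have "a i * e j - a j * e i = a i * a j * (of_nat (Suc i) - of_nat (Suc j)) / (of_nat (Suc i) * of_nat (Suc j))"
      by (simp add: e_def field_simps del: of_nat_Suc)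
    then show ?thesis using a[OF that(1)] a[OF that(2)] that(3) by (simp del: of_nat_Suc)
  qed
  ultimately have "T \<noteq> 0" by (auto simp: T_def)
  then have "finite {s. poly T s = 0}" by (rule poly_roots_finite)
  then obtain s where s: "poly T s \<noteq> 0"
    using ex_new_if_finite[OF infinite_UNIV_char_0] by blast
  define b where "b = (\<lambda>i\<in>{..<N}. c i + s * e i)"
  have b_eq: "b i = c i + s * e i" if "i < N" for i using that by (simp add: b_def)
  have "meval b f = poly P s" unfolding P using f(1) S(1) b_eq by (intro meval_cong) auto
  then have "meval b f \<noteq> 0" using s by (simp add: T_def)
  moreover have "b \<in> {..<N} \<rightarrow>\<^sub>E UNIV" by (simp add: b_def)
  ultimately have "b \<in> U" using S(2) f(1) by blast
  moreover have nz: "b i \<noteq> 0" if "i < N" for i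
    using s that by (auto simp: T_def poly_prod b_eq)
  moreover have "inj_on (\<lambda>i. a i / b i) {..<N}"
  proof (rule inj_onI)
    fix i j assume ij: "i \<in> {..<N}" "j \<in> {..<N}" "a i / b i = a j / b j"
    show "i = j"
    proof (rule ccontr)
      assume "i \<noteq> j"
      then have "a i * c j - a j * c i + s * (a i * e j - a j * e i) \<noteq> 0"
        using s ij by (auto simp: T_def poly_prod)
      moreover have "a i * b j - a j * b i = 0" using ij nz by (simp add: field_simps)
      then have "a i * c j - a j * c i + s * (a i * e j - a j * e i) = 0"
        using ij by (simp add: b_eq algebra_simps)
      ultimately show False by blast
    qed
  qed
  ultimately show ?thesis by (rule that)
qed

lemma not_WLP_power_ideal:
  fixes a :: "nat \<Rightarrow> 'a::field_char_0"
  assumes a: "\<And>i. i < 2 * n \<Longrightarrow> a i \<noteq> 0" and n: "3 \<le> n" and d: "2 \<le> d"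
  shows "\<not> WLP (2 * n) (power_ideal (2 * n) d (lform (2 * n) a))"
proof
  let ?N = "2 * n"
  let ?I = "power_ideal ?N d (lform ?N a)"
  assume "WLP ?N ?I"
  then obtain U where U: "zariski_open ?N U" "U \<noteq> {}" and max_rank:
    "\<forall>l\<in>homog ?N 1. coeff_vec ?N l \<in> U \<longrightarrow> (\<forall>t.
       let mult_l = (\<lambda>A. (?I +>\<^bsub>mpoly_ring ?N\<^esub> l) \<otimes>\<^bsub>mpoly_ring ?N Quot ?I\<^esub> A) in
         inj_on mult_l (quot_homog ?N ?I t) \<or>
         mult_l ` quot_homog ?N ?I t = quot_homog ?N ?I (t + 1))"
    unfolding WLP_def for_general_linear_form_def by blast
  obtain b where b: "b \<in> U" "\<And>i. i < ?N \<Longrightarrow> b i \<noteq> 0" "inj_on (\<lambda>i. a i / b i) {..<?N}"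
    using general_point_exists[where N = ?N and a = a, OF a U] by blast
  have "b \<in> {..<?N} \<rightarrow>\<^sub>E UNIV" using U(1) b(1) by (auto simp: zariski_open_def)
  then have "coeff_vec ?N (lform ?N b) \<in> U" using b(1) by (simp add: coeff_vec_lform)
  from max_rank[rule_format, OF lform_homog this, of "int n * (int d - 1) - 1"]
  show False
    using multiplication_not_max_rank[where n = n and a = a and b = b and d = d, OF a b(2,3) n d]
    unfolding Let_def diff_add_cancel by blast
qed

text \<open>
The ideal is the maximal homogeneous ideal, so the quotient is zero in all degrees other than \<open>0\<close>.
\<close>

lemma WLP_power_ideal_1:
  fixes a :: "nat \<Rightarrow> 'a::field"
  shows "WLP N (power_ideal N 1 (lform N a))"
proof -
  let ?I = "power_ideal N 1 (lform N a)" and ?R = "mpoly_ring N :: 'a mpoly ring"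
  interpret R: cring ?R by (rule cring_mpoly_ring)
  interpret I: ideal ?I ?R by (rule ideal_power_ideal[OF lform_carrier])
  have trivial: "?I +>\<^bsub>?R\<^esub> p = ?I" if p: "p \<in> homog N t" and t: "t \<noteq> 0" for p t
  proof (rule I.a_rcos_const)
    have "0 \<notin> Poly_Mapping.keys p"
    proof
      assume "0 \<in> Poly_Mapping.keys p"
      then have "int (mdegree 0) = t" using p by (simp add: homog_def)
      with t show False using mdegree_eq_0_iff[of 0] by simp
    qed
    then have "lookup p 0 = 0" by (simp add: in_keys_iff)
    moreover have "m = 0" if "m \<in> small_monoms 1 N j" for m j
      using that by (intro poly_mapping_eqI) (simp add: small_monoms_def)
    ultimately have "vanish 1 N j (p - lform N a ^ 1 * 0)" for j by (auto simp: vanish_def)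
    then show "p \<in> ?I"
      by (intro vanish_imp_power_ideal[of _ _ _ 0])
         (auto intro: homog_carrier[OF p] simp: lform_carrier mpoly_ring_closed)
  qed
  have zero: "0 \<in> homog N t" for t by (simp add: homog_def mpoly_ring_closed)
  have quot: "quot_homog N ?I t = {?I}" if "t \<noteq> 0" for t
    using trivial[OF _ that] zero[of t] by (force simp: quot_homog_def)
  have max_rank: "let mult_l = (\<lambda>A. (?I +>\<^bsub>?R\<^esub> l) \<otimes>\<^bsub>?R Quot ?I\<^esub> A) in
      inj_on mult_l (quot_homog N ?I t) \<or> mult_l ` quot_homog N ?I t = quot_homog N ?I (t + 1)"
    if l: "l \<in> homog N 1" for l t
  proof (cases "t = 0")
    case True
    have "(?I +>\<^bsub>?R\<^esub> l) \<otimes>\<^bsub>?R Quot ?I\<^esub> (?I +>\<^bsub>?R\<^esub> p) = ?I" if "p \<in> homog N 0" for p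
    proof -
      have "(?I +>\<^bsub>?R\<^esub> l) \<otimes>\<^bsub>?R Quot ?I\<^esub> (?I +>\<^bsub>?R\<^esub> p) = ?I +>\<^bsub>?R\<^esub> (l * p)"
        using I.rcoset_mult_add[OF homog_carrier[OF l] homog_carrier[OF that]] by (simp add: FactRing_def)
      also have "\<dots> = ?I" using homog_mult[OF l that] by (intro trivial[of _ 1]) simp_all
      finally show ?thesis .
    qed
    then have "(\<lambda>A. (?I +>\<^bsub>?R\<^esub> l) \<otimes>\<^bsub>?R Quot ?I\<^esub> A) ` quot_homog N ?I 0 = {?I}"
      using zero[of 0] by (force simp: quot_homog_def)
    then show ?thesis using True quot[of 1] by (simp add: Let_def)
  next
    case False
    then show ?thesis unfolding Let_def quot[OF False] by (intro disjI1 inj_onI) blast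
  qed
  have "zariski_open N ({..<N} \<rightarrow>\<^sub>E (UNIV :: 'a set))"
    unfolding zariski_open_def zariski_closed_def
    by (intro conjI subset_refl exI[of _ "{1}"]) (auto simp: mpoly_ring_closed meval_def)
  moreover have "({..<N} \<rightarrow>\<^sub>E (UNIV :: 'a set)) \<noteq> {}" by (simp add: PiE_eq_empty_iff)
  ultimately show ?thesis
    unfolding WLP_def for_general_linear_form_def using max_rank by blast
qed

text \<open>
The complement is the zero set of the product of all variables.
\<close>

lemma zariski_open_torus:
  "zariski_open N {c \<in> {..<N} \<rightarrow>\<^sub>E (UNIV :: 'a::field set). \<forall>i<N. c i \<noteq> 0}"
proof -
  define f where "f = Poly_Mapping.single (ind_monom {..<N}) (1::'a)"
  have keys: "Poly_Mapping.keys (ind_monom {..<N}) = {..<N}"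
    by (auto simp: in_keys_iff lookup_ind_monom split: if_splits)
  have "meval c f = (\<Prod>i<N. c i)" for c
    by (simp add: meval_def f_def keys lookup_ind_monom)
  moreover have "f \<in> carrier (mpoly_ring N)" by (simp add: f_def mpoly_ring_carrier keys)
  ultimately show ?thesis
    unfolding zariski_open_def zariski_closed_def by (intro conjI exI[of _ "{f}"]) auto
qed

theorem theorem5p1:
  fixes n d :: nat
  assumes "n \<ge> 3" and "d \<ge> 1"
  shows "for_general_linear_form (2 * n) (\<lambda>L :: 'k::field_char_0 mpoly.
           \<not> WLP (2 * n) (Idl\<^bsub>mpoly_ring (2 * n)\<^esub> ({mvar i ^ d | i. i < 2 * n} \<union> {L ^ d}))
           \<longleftrightarrow> d > 1)"
  unfolding for_general_linear_form_def
proof (intro exI conjI ballI impI)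
  let ?U = "{c \<in> {..<2 * n} \<rightarrow>\<^sub>E (UNIV :: 'k set). \<forall>i<2 * n. c i \<noteq> 0}"
  show "zariski_open (2 * n) ?U" by (rule zariski_open_torus)
  have "(\<lambda>i\<in>{..<2 * n}. 1) \<in> ?U" by simp
  then show "?U \<noteq> {}" by blast
  fix L :: "'k mpoly" assume L: "L \<in> homog (2 * n) 1" and U: "coeff_vec (2 * n) L \<in> ?U"
  show "\<not> WLP (2 * n) (power_ideal (2 * n) d L) \<longleftrightarrow> d > 1"
  proof (cases "d = 1")
    case True
    have "WLP (2 * n) (power_ideal (2 * n) d L)"
      unfolding True by (subst lform_coeff_vec[OF L]) (rule WLP_power_ideal_1)
    then show ?thesis using True by simp
  next
    case False
    then have "2 \<le> d" using assms(2) by simp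
    moreover have "coeff_vec (2 * n) L i \<noteq> 0" if "i < 2 * n" for i using U that by blast
    ultimately have "\<not> WLP (2 * n) (power_ideal (2 * n) d (lform (2 * n) (coeff_vec (2 * n) L)))"
      using not_WLP_power_ideal[OF _ assms(1)] by blast
    then have "\<not> WLP (2 * n) (power_ideal (2 * n) d L)"
      unfolding lform_coeff_vec[OF L, symmetric] .
    then show ?thesis using \<open>2 \<le> d\<close> by simp
  qed
qed

end
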